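(* For every $G_6$-orbit consisting of $3$ lines in $\mathbb{P}^5$, there is a unique pencil of $G_6$-invariant pencils of cubics containing these lines; that is, the $G_6$-invariant pencils of cubics all of whose members contain the three lines are parametrized by a line in the $\mathbb{P}^3$ of all $G_6$-invariant pencils of cubics.
   Context: We work over $\mathbb{C}$. Let $x_0,\dots,x_5$ be homogeneous coordinates on $\mathbb{P}^5$, indices modulo $6$, and $\rho=e^{2\pi i/6}$. The Heisenberg group $H_6$ is generated by $\sigma:x_i\mapsto x_{i+1}$ and $\tau:x_i\mapsto\rho^i x_i$; the involution $\iota$ is $x_i\mapsto x_{-i}$, and $G_6=\langle H_6,\iota\rangle$. The space of cubic forms, as a $G_6$-module, contains exactly a $4$-fold multiple of one $2$-dimensional irreducible representation (all other irreducible summands being $4$-dimensional), so the $G_6$-invariant pencils of cubics are parametrized by a $\mathbb{P}^3$ with coordinates $(a:b:c:d)$: the pencil corresponding to $(a:b:c:d)$ is spanned by $$a(x_0^3+x_2^3+x_4^3)+b\,x_0x_2x_4+c(x_3^2x_0+x_5^2x_2+x_1^2x_4)+d(x_1x_2x_3+x_3x_4x_5+x_5x_0x_1)$$ and $$a(x_1^3+x_3^3+x_5^3)+b\,x_1x_3x_5+c(x_4^2x_1+x_0^2x_3+x_2^2x_5)+d(x_2x_3x_4+x_4x_5x_0+x_0x_1x_2).$$ A pencil of pencils is a line in this $\mathbb{P}^3$. *)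

theory Defs
  imports
    "HOL-Analysis.Analysis"
    "HOL-Library.Function_Algebras"
    "HOL-Algebra.Bij"
    "HOL-Algebra.Elementary_Groups"
    "HOL-Algebra.Group_Action"
begin

text \<open>
  Coordinates are indexed by the numeral type \<open>6\<close>, whose ring structure is that of the
  integers modulo 6, so that \<open>i + 1\<close> and \<open>- i\<close> are computed modulo 6.
\<close>

subsection \<open>Projective spaces and their lines\<close>

text \<open>
  A point is a one-dimensional linear subspace of \<open>complex ^ 'n\<close>, and a projective
  line is the set of points in a two-dimensional linear subspace.
\<close>

definition proj_points :: "(complex ^ 'n) set set" where
  "proj_points = {P. vec.subspace P \<and> vec.dim P = 1}"

definition proj_lines :: "(complex ^ 'n) set set set" where
  "proj_lines = {{P \<in> proj_points. P \<subseteq> W} | W. vec.subspace W \<and> vec.dim W = 2}"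

subsection \<open>The groups \<open>H\<^sub>6\<close> and \<open>G\<^sub>6\<close>\<close>

definition rho :: complex where
  "rho = exp (2 * of_real pi * \<i> / 6)"

definition sigma :: "complex ^ 6 \<Rightarrow> complex ^ 6" where
  "sigma x = (\<chi> i. x $ (i + 1))"

text \<open>\<open>Rep_bit0 i\<close> is the representative of \<open>i\<close> in \<open>{0..<6}\<close>.\<close>

definition tau :: "complex ^ 6 \<Rightarrow> complex ^ 6" where
  "tau x = (\<chi> i. rho powi (Rep_bit0 i) * x $ i)"

definition iota :: "complex ^ 6 \<Rightarrow> complex ^ 6" where
  "iota x = (\<chi> i. x $ (- i))"

text \<open>
  \<open>subgroup_generated\<close> intersects its second argument with the carrier; the lemma below
  says that nothing is lost.
\<close>

lemma generators_in_BijGroup: "{sigma, tau, iota} \<subseteq> carrier (BijGroup UNIV)"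
proof -
  have "bij sigma"
    by (rule o_bij[where g = "\<lambda>x. \<chi> i. x $ (i - 1)"]) (auto simp: sigma_def vec_eq_iff)
  moreover have "bij tau"
  proof (rule o_bij[where g = "\<lambda>x. \<chi> i. inverse (rho powi (Rep_bit0 i)) * x $ i"])
    have "rho \<noteq> 0" by (simp add: rho_def)
    then show "(\<lambda>x. \<chi> i. inverse (rho powi (Rep_bit0 i)) * x $ i) \<circ> tau = id"
      and "tau \<circ> (\<lambda>x. \<chi> i. inverse (rho powi (Rep_bit0 i)) * x $ i) = id"
      by (auto simp: tau_def vec_eq_iff fun_eq_iff)
  qed
  moreover have "bij iota"
    by (rule o_bij[where g = iota]) (auto simp: iota_def vec_eq_iff)
  ultimately show ?thesis
    by (auto simp: BijGroup_def Bij_def)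
qed

definition H6 :: "(complex ^ 6 \<Rightarrow> complex ^ 6) monoid" where
  "H6 = subgroup_generated (BijGroup UNIV) {sigma, tau}"

definition G6 :: "(complex ^ 6 \<Rightarrow> complex ^ 6) monoid" where
  "G6 = subgroup_generated (BijGroup UNIV) (insert iota (carrier H6))"

definition act_line ::
    "(complex ^ 6 \<Rightarrow> complex ^ 6) \<Rightarrow> (complex ^ 6) set set \<Rightarrow> (complex ^ 6) set set" where
  "act_line g L = (\<lambda>P. g ` P) ` L"

definition G6_line_orbits :: "(complex ^ 6) set set set set" where
  "G6_line_orbits = orbits G6 proj_lines act_line"

subsection \<open>Cubic forms and invariant pencils\<close>

text \<open>
  A form is identified with the polynomial function it defines, which is harmless over
  the complex numbers.
\<close>

interpretation form: vector_space
  "\<lambda>(c :: complex) (F :: complex ^ 6 \<Rightarrow> complex) x. c * F x"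
  by unfold_locales (auto simp: fun_eq_iff algebra_simps)

definition cubic_forms :: "(complex ^ 6 \<Rightarrow> complex) set" where
  "cubic_forms = form.span {\<lambda>x. x $ i * x $ j * x $ k | i j k. True}"

definition G6_invariant_pencils :: "(complex ^ 6 \<Rightarrow> complex) set set" where
  "G6_invariant_pencils =
    {V. form.subspace V \<and> V \<subseteq> cubic_forms \<and> form.dim V = 2
      \<and> (\<forall>g \<in> carrier G6. \<forall>F \<in> V. F \<circ> g \<in> V)}"

definition zero_locus :: "(complex ^ 6 \<Rightarrow> complex) \<Rightarrow> (complex ^ 6) set set" where
  "zero_locus F = {P \<in> proj_points. \<forall>x \<in> P. F x = 0}"

definition contains_lines ::
    "(complex ^ 6 \<Rightarrow> complex) set \<Rightarrow> (complex ^ 6) set set set \<Rightarrow> bool" where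
  "contains_lines V \<L> \<longleftrightarrow> (\<forall>F \<in> V. \<forall>L \<in> \<L>. L \<subseteq> zero_locus F)"

text \<open>The coordinates \<open>(a : b : c : d)\<close> are the components 0, 1, 2, 3 of a vector indexed
  by the numeral type \<open>4\<close>.\<close>

definition cubic_even :: "complex ^ 4 \<Rightarrow> complex ^ 6 \<Rightarrow> complex" where
  "cubic_even p x =
     p $ 0 * ((x $ 0)^3 + (x $ 2)^3 + (x $ 4)^3)
   + p $ 1 * (x $ 0 * x $ 2 * x $ 4)
   + p $ 2 * ((x $ 3)^2 * x $ 0 + (x $ 5)^2 * x $ 2 + (x $ 1)^2 * x $ 4)
   + p $ 3 * (x $ 1 * x $ 2 * x $ 3 + x $ 3 * x $ 4 * x $ 5 + x $ 5 * x $ 0 * x $ 1)"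

definition cubic_odd :: "complex ^ 4 \<Rightarrow> complex ^ 6 \<Rightarrow> complex" where
  "cubic_odd p x =
     p $ 0 * ((x $ 1)^3 + (x $ 3)^3 + (x $ 5)^3)
   + p $ 1 * (x $ 1 * x $ 3 * x $ 5)
   + p $ 2 * ((x $ 4)^2 * x $ 1 + (x $ 0)^2 * x $ 3 + (x $ 2)^2 * x $ 5)
   + p $ 3 * (x $ 2 * x $ 3 * x $ 4 + x $ 4 * x $ 5 * x $ 0 + x $ 0 * x $ 1 * x $ 2)"

text \<open>
  \<open>P\<close> is a point of projective 3-space, so all its nonzero vectors are proportional and
  give the same span.
\<close>

definition pencil_of :: "(complex ^ 4) set \<Rightarrow> (complex ^ 6 \<Rightarrow> complex) set" where
  "pencil_of P = form.span (cubic_even ` P \<union> cubic_odd ` P)"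

end

theory Submission
  imports Defs
begin

text \<open>
  By the Chinese remainder theorem, reducing indices modulo 2 and modulo 3 identifies \<open>\<complex>\<^sup>6\<close> with
  \<open>\<complex>\<^sup>2 \<otimes> \<complex>\<^sup>3\<close>, on which \<open>\<sigma>\<^sup>3, \<tau>\<^sup>3\<close> act irreducibly through the first factor and
  \<open>\<sigma>\<^sup>2, \<tau>\<^sup>2\<close> through the second.

  Up to scalars \<open>\<sigma>\<close> and \<open>\<tau>\<close> commute, so they permute the three lines of an orbit as commuting
  permutations. A line fixed by both would have an orbit of at most two lines, the second one being
  its image under \<open>\<iota>\<close>. Hence each of \<open>\<sigma>\<close> and \<open>\<tau>\<close> acts trivially or as a 3-cycle
  (\<open>all_or_none_fixed\<close>). It follows that \<open>\<sigma>\<^sup>3\<close> and \<open>\<tau>\<^sup>3\<close> fix every line, so each line is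
  \<open>\<complex>\<^sup>2 \<otimes> v\<close> for some \<open>v\<close> in \<open>\<complex>\<^sup>3\<close> (\<open>sigma3_tau3_invariant_plane\<close>), and that, besides, \<open>\<tau>\<close> or some
  \<open>\<tau>\<^sup>-\<^sup>k\<sigma>\<close> fixes the line. The latter makes \<open>v\<close> an eigenvector of a nontrivial element of the
  Heisenberg group of level 3. Such a \<open>v\<close> is a vertex of one of the four triangles of the Hesse
  pencil and not one of its base points, which means that \<open>A = v\<^sub>0\<^sup>3 + v\<^sub>1\<^sup>3 + v\<^sub>2\<^sup>3\<close> and
  \<open>B = v\<^sub>0 v\<^sub>1 v\<^sub>2\<close> do not both vanish (\<open>plane_invariants_nonzero\<close>).

  On the vectors \<open>(s, t) \<otimes> v\<close> the two cubics with parameters \<open>(a, b, c, d)\<close> become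
  \<open>s\<^sup>3 (aA + bB) + s t\<^sup>2 (cA + 3dB)\<close> and the same expression with \<open>s\<close> and \<open>t\<close> exchanged
  (\<open>cubic_on_plane\<close>). A pencil therefore contains the line if and only if \<open>aA + bB = 0\<close> and
  \<open>cA + 3dB = 0\<close>, which are two independent conditions and so define a line of parameters. Since
  the pencil is invariant, it then contains the whole orbit.

  What remains is that each invariant pencil \<open>V\<close> has such parameters
  (\<open>invariant_pencil_classification\<close>). On cubic forms the operators \<open>\<sigma>\<close> and \<open>\<tau>\<close> anticommute
  because \<open>\<rho>\<^sup>3 = -1\<close>. So \<open>V\<close> is spanned by an eigenvector of \<open>\<tau>\<close> and its translate by \<open>\<sigma>\<close>, whose
  eigenvalues are \<open>c\<close> and \<open>-c\<close>. As \<open>\<iota>\<close> inverts eigenvalues of \<open>\<tau>\<close> and \<open>c\<^sup>6 = 1\<close>, one of the two is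
  1; the form with eigenvalue 1 is then also fixed by \<open>\<sigma>\<^sup>2\<close>, because conjugation by \<open>\<iota>\<close> inverts
  \<open>\<sigma>\<close>. Averaging over the group generated by \<open>\<tau>\<close> and \<open>\<sigma>\<^sup>2\<close> shows that the fixed cubic forms
  are exactly the first members of the given family.
\<close>

section \<open>Indices modulo 6 and the sixth root of unity\<close>

text \<open>
  Rewriting to the representatives \<open>0, \<dots>, 5\<close> lets the simplifier compute with coordinate indices.
\<close>

lemma num6_reduce [simp]:
  "(6::6) = 0" "(7::6) = 1" "(8::6) = 2" "(9::6) = 3" "(10::6) = 4"
  "(-1::6) = 5" "(-2::6) = 4" "(-3::6) = 3" "(-4::6) = 2" "(-5::6) = 1"
  by (simp_all add: bit0.Rep_inject_sym bit0.Rep_numeral bit0.Rep_0 bit0.Rep_1 bit0.minus_def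
      bit0.Rep_Abs_mod bit0.Abs_inverse)

lemma num6_distinct [simp]:
  "(0::6) \<noteq> 1" "(0::6) \<noteq> 2" "(0::6) \<noteq> 3" "(0::6) \<noteq> 4" "(0::6) \<noteq> 5"
  "(1::6) \<noteq> 2" "(1::6) \<noteq> 3" "(1::6) \<noteq> 4" "(1::6) \<noteq> 5"
  "(2::6) \<noteq> 3" "(2::6) \<noteq> 4" "(2::6) \<noteq> 5" "(3::6) \<noteq> 4" "(3::6) \<noteq> 5" "(4::6) \<noteq> 5"
  by (simp_all add: bit0.Rep_inject_sym bit0.Rep_numeral bit0.Rep_0 bit0.Rep_1)

lemma num4_distinct [simp]:
  "(0::4) \<noteq> 1" "(0::4) \<noteq> 2" "(0::4) \<noteq> 3" "(1::4) \<noteq> 2" "(1::4) \<noteq> 3" "(2::4) \<noteq> 3"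
  by (simp_all add: bit0.Rep_inject_sym bit0.Rep_numeral bit0.Rep_0 bit0.Rep_1)

lemmas num6_distinct' [simp] = num6_distinct [symmetric]
lemmas num4_distinct' [simp] = num4_distinct [symmetric]

lemma forall_6: "(\<forall>i::6. P i) \<longleftrightarrow> P 0 \<and> P 1 \<and> P 2 \<and> P 3 \<and> P 4 \<and> P 5"
proof (intro iffI allI; (elim conjE)?)
  fix i :: 6
  assume P: "P 0" "P 1" "P 2" "P 3" "P 4" "P 5"
  show "P i"
  proof (cases i)
    case (of_int z)
    then have "z \<in> {0, 1, 2, 3, 4, 5}" by auto
    with of_int P show ?thesis by auto
  qed
qed simp

lemma forall_4_from_0: "(\<forall>i::4. P i) \<longleftrightarrow> P 0 \<and> P 1 \<and> P 2 \<and> P 3"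
proof -
  have 40: "(4::4) = 0" by (simp add: bit0.Rep_inject_sym bit0.Rep_numeral bit0.Rep_0)
  show ?thesis unfolding forall_4 40 by auto
qed

lemma vec6_eq_iff:
  fixes x y :: "complex ^ 6"
  shows "x = y \<longleftrightarrow> x$0 = y$0 \<and> x$1 = y$1 \<and> x$2 = y$2 \<and> x$3 = y$3 \<and> x$4 = y$4 \<and> x$5 = y$5"
  unfolding vec_eq_iff by (rule forall_6)

lemma rho_root: "rho^2 = rho - 1" "rho^6 = 1" "rho \<noteq> 0"
proof -
  have 3: "rho^3 = -1"
    by (simp add: rho_def flip: exp_of_nat_mult)
  have "Re rho = cos (pi/3)" by (simp add: rho_def Re_exp)
  then have "Re rho > 0" by (simp add: cos_60)
  then have "rho \<noteq> -1" by (metis one_complex.sel(1) neg_0_less_iff_less not_one_less_zero uminus_complex.sel(1))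
  \<comment> \<open>The factorisation of \<open>rho\<^sup>3 + 1\<close>.\<close>
  moreover have "(rho + 1) * (rho^2 - (rho - 1)) = 0"
    using 3 by (simp add: algebra_simps power2_eq_square power3_eq_cube)
  ultimately show "rho^2 = rho - 1" by (auto simp: add_eq_0_iff2)
  have "rho^6 = (rho^3)^2" by simp
  with 3 show "rho^6 = 1" by simp
  show "rho \<noteq> 0" by (simp add: rho_def)
qed

lemma rho_powers:
  "rho^2 = rho - 1" "rho^3 = -1" "rho^4 = -rho" "rho^5 = 1 - rho" "rho * rho = rho - 1"
proof -
  show 2: "rho^2 = rho - 1" and "rho * rho = rho - 1"
    using rho_root(1) by (simp_all add: power2_eq_square)
  have "rho^3 = rho * (rho - 1)" unfolding 2[symmetric] by (simp add: eval_nat_numeral)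
  then show 3: "rho^3 = -1" using 2 by (simp add: right_diff_distrib power2_eq_square)
  have "rho^4 = rho * rho^3" "rho^5 = rho^2 * rho^3" by (simp_all add: eval_nat_numeral)
  then show "rho^4 = -rho" "rho^5 = 1 - rho" unfolding 2 3 by simp_all
qed

text \<open>
  Together with \<open>rho_powers\<close> this rule reduces polynomials in \<open>rho\<close> to the normal form \<open>a + b * rho\<close>.
\<close>

lemma rho_rho_mult: "rho * (rho * z) = rho * z - z"
proof -
  have "rho * (rho * z) = rho^2 * z" by (simp add: power2_eq_square)
  then show ?thesis using rho_root(1) by (simp add: left_diff_distrib)
qed

text \<open>
  The \<open>i\<close>-th eigenvalue of \<open>tau\<close>, which as a function of \<open>i\<close> is a character of \<open>\<int>/6\<close>.
\<close>

definition weight :: "6 \<Rightarrow> complex" where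
  "weight i = rho powi Rep_bit0 i"

lemma weight_simps [simp]:
  "weight 0 = 1" "weight 1 = rho" "weight 2 = rho^2" "weight 3 = rho^3" "weight 4 = rho^4" "weight 5 = rho^5"
  by (simp_all add: weight_def bit0.Rep_numeral bit0.Rep_0 bit0.Rep_1)

lemma weight_add: "weight (i + j) = weight i * weight j"
proof -
  have "\<forall>i j. weight (i + j) = weight i * weight j"
    unfolding forall_6 by (simp add: rho_powers rho_rho_mult algebra_simps)
  then show ?thesis by blast
qed

lemma weight_power_6: "weight i ^ 6 = 1"
proof -
  have "(rho ^ n) ^ 6 = (rho ^ 6) ^ n" for n by (simp only: mult.commute flip: power_mult)
  then have pow: "(rho ^ n) ^ 6 = 1" for n by (simp add: rho_root(2))
  have "\<forall>i. weight i ^ 6 = 1"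
    unfolding forall_6 weight_simps by (simp only: pow rho_root(2) power_one simp_thms)
  then show ?thesis by blast
qed

lemma weight_eq_1_iff: "weight i = 1 \<longleftrightarrow> i = 0"
proof -
  have "r \<noteq> 2 \<and> r \<noteq> 1 \<and> - r \<noteq> 1" if "r^2 = r - 1" for r :: complex
    using that by (auto simp: power2_eq_square minus_equation_iff[of r])
  from this[OF rho_powers(1)] have "\<forall>i. weight i = 1 \<longleftrightarrow> i = 0"
    unfolding forall_6 by (auto simp: rho_powers bit0.Rep_inject_sym bit0.Rep_numeral bit0.Rep_0 bit0.Rep_1 rho_root(3))
  then show ?thesis by blast
qed

text \<open>
  These are the eigenvalues of \<open>tau ^^ 3\<close>: its eigenspaces are the vectors supported on the even and on
  the odd indices.
\<close>

lemma weight_cube: "weight 0 ^ 3 = 1" "weight 1 ^ 3 = -1" "weight 2 ^ 3 = 1"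
  "weight 3 ^ 3 = -1" "weight 4 ^ 3 = 1" "weight 5 ^ 3 = -1"
proof -
  have "(rho ^ n) ^ 3 = (rho ^ 3) ^ n" for n by (simp only: mult.commute flip: power_mult)
  then have pow: "(rho ^ n) ^ 3 = (-1) ^ n" for n by (simp add: rho_powers(2))
  show "weight 0 ^ 3 = 1" "weight 1 ^ 3 = -1" "weight 2 ^ 3 = 1"
    "weight 3 ^ 3 = -1" "weight 4 ^ 3 = 1" "weight 5 ^ 3 = -1"
    unfolding weight_simps pow by (simp_all add: rho_powers(2))
qed

section \<open>The group generated by sigma, tau and iota\<close>

lemma sigma_nth [simp]: "sigma x $ i = x $ (i + 1)" by (simp add: sigma_def)
lemma iota_nth [simp]: "iota x $ i = x $ (- i)" by (simp add: iota_def)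

lemma tau_nth [simp]:
  "tau x $ 0 = x $ 0" "tau x $ 1 = rho * x $ 1" "tau x $ 2 = rho^2 * x $ 2"
  "tau x $ 3 = rho^3 * x $ 3" "tau x $ 4 = rho^4 * x $ 4" "tau x $ 5 = rho^5 * x $ 5"
  by (simp_all add: tau_def bit0.Rep_numeral bit0.Rep_0 bit0.Rep_1)

lemma bij_gens: "bij sigma" "bij tau" "bij iota"
  using generators_in_BijGroup by (auto simp: BijGroup_def Bij_def)

lemma sigma_6: "(sigma ^^ 6) x = x" and iota_2: "iota (iota x) = x"
  by (simp_all add: vec6_eq_iff numeral_eq_Suc)

lemma tau_funpow_weight: "(tau ^^ n) x $ i = weight i ^ n * x $ i"
  by (induction n) (simp_all add: tau_def weight_def)

lemma tau_6: "(tau ^^ 6) x = x"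
  by (simp add: vec_eq_iff tau_funpow_weight weight_power_6)

text \<open>
  The first relation says that \<open>sigma\<close> and \<open>tau\<close> commute up to a scalar, the others that conjugation by
  \<open>iota\<close> inverts \<open>tau\<close> and \<open>sigma\<close>.
\<close>

lemma generator_relations:
  "sigma (tau x) = rho *s tau (sigma x)"
  "tau (iota (tau x)) = iota x" "sigma (iota (sigma x)) = iota x"
  by (simp_all add: vec6_eq_iff rho_powers rho_rho_mult algebra_simps)

lemma carrier_BijGroup_UNIV [simp]: "carrier (BijGroup UNIV) = Collect bij"
  by (auto simp: BijGroup_def Bij_def)

lemma mult_BijGroup_UNIV [simp]: "bij g \<Longrightarrow> bij h \<Longrightarrow> g \<otimes>\<^bsub>BijGroup UNIV\<^esub> h = g \<circ> h"
  by (auto simp: BijGroup_def Bij_def compose_def)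

lemma one_BijGroup_UNIV [simp]: "\<one>\<^bsub>BijGroup UNIV\<^esub> = id"
  by (auto simp: BijGroup_def)

lemma inv_BijGroup_UNIV [simp]: "bij g \<Longrightarrow> m_inv (BijGroup UNIV) g = inv_into UNIV g"
  by (subst inv_BijGroup) (auto simp: Bij_def)

lemma inv_gens: "inv_into UNIV sigma = sigma ^^ 5" "inv_into UNIV tau = tau ^^ 5" "inv_into UNIV iota = iota"
proof -
  have inv: "inv_into UNIV g = g ^^ 5" if "\<And>x. (g ^^ 6) x = x" for g :: "complex ^ 6 \<Rightarrow> complex ^ 6"
  proof (rule inv_unique_comp)
    have 6: "g ^^ 6 = id" using that by auto
    show "g \<circ> g ^^ 5 = id" using 6 funpow.simps(2)[of 5 g] by simp
    show "g ^^ 5 \<circ> g = id" using 6 funpow_Suc_right[of 5 g] by simp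
  qed
  show "inv_into UNIV sigma = sigma ^^ 5" "inv_into UNIV tau = tau ^^ 5"
    by (simp_all add: inv sigma_6 tau_6)
  show "inv_into UNIV iota = iota"
    by (rule inv_unique_comp) (auto simp: iota_2)
qed

text \<open>
  Inverses require no case of their own, since the generators have finite order and their inverses are
  powers of them.
\<close>

lemma G6_induct [consumes 1, case_names id sigma tau iota comp]:
  assumes g: "g \<in> carrier G6"
    and gens: "P id" "P sigma" "P tau" "P iota"
    and comp: "\<And>g h. P g \<Longrightarrow> P h \<Longrightarrow> P (g \<circ> h)"
  shows "P g"
proof -
  let ?B = "BijGroup (UNIV :: (complex ^ 6) set)"
  let ?S = "{g. bij g \<and> P g \<and> P (inv_into UNIV g)}"
  interpret B: group ?B by (rule group_BijGroup)
  have S: "subgroup ?S ?B"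
  proof (rule B.subgroupI)
    have "id \<in> ?S" using gens(1) by (simp add: id_def[symmetric] inv_id)
    then show "?S \<noteq> {}" by blast
  qed (use comp in \<open>auto simp: bij_imp_bij_inv inv_inv_eq o_inv_distrib bij_comp\<close>)
  have pow: "P (g ^^ n)" if "P g" for g n
  proof (induction n)
    case 0
    show ?case using gens(1) by (simp add: id_def)
  next
    case (Suc n)
    show ?case unfolding funpow.simps by (rule comp[OF that Suc])
  qed
  have gS: "{sigma, tau, iota} \<subseteq> ?S"
    using gens pow by (auto simp: bij_gens inv_gens)
  then have "carrier H6 \<subseteq> ?S"
    unfolding H6_def by (intro B.subgroup_generated_minimal S) auto
  with gS have "carrier G6 \<subseteq> ?S"
    unfolding G6_def by (intro B.subgroup_generated_minimal S) auto
  with g show ?thesis by auto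
qed

lemma G6_closed:
  "id \<in> carrier G6" "sigma \<in> carrier G6" "tau \<in> carrier G6" "iota \<in> carrier G6"
  "g \<in> carrier G6 \<Longrightarrow> h \<in> carrier G6 \<Longrightarrow> g \<circ> h \<in> carrier G6"
  "g \<in> carrier G6 \<Longrightarrow> inv_into UNIV g \<in> carrier G6"
  "g \<in> carrier G6 \<Longrightarrow> bij g"
proof -
  let ?B = "BijGroup (UNIV :: (complex ^ 6) set)"
  interpret B: group ?B by (rule group_BijGroup)
  have H: "sigma \<in> carrier H6" "tau \<in> carrier H6"
    by (auto simp: H6_def carrier_subgroup_generated bij_gens intro: generate.incl)
  have HB: "carrier H6 \<subseteq> carrier ?B"
    unfolding H6_def by (rule B.carrier_subgroup_generated_subset)
  have sub: "subgroup (carrier G6) ?B"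
    unfolding G6_def by (rule B.subgroup_subgroup_generated)
  show bij: "g \<in> carrier G6 \<Longrightarrow> bij g" for g using subgroup.subset[OF sub] by auto
  show "id \<in> carrier G6" using subgroup.one_closed[OF sub] by simp
  show "sigma \<in> carrier G6" "tau \<in> carrier G6" "iota \<in> carrier G6"
    using H HB unfolding G6_def
    by (auto simp: carrier_subgroup_generated bij_gens intro!: generate.incl)
  show "g \<in> carrier G6 \<Longrightarrow> h \<in> carrier G6 \<Longrightarrow> g \<circ> h \<in> carrier G6"
    using subgroup.m_closed[OF sub, of g h] by (simp add: bij)
  show "g \<in> carrier G6 \<Longrightarrow> inv_into UNIV g \<in> carrier G6"
    using subgroup.m_inv_closed[OF sub, of g] by (simp add: bij)
qed

lemma G6_linear: "g \<in> carrier G6 \<Longrightarrow> Vector_Spaces.linear (*s) (*s) g"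
proof (induction rule: G6_induct)
  case id
  then show ?case by unfold_locales simp_all
next
  case sigma
  then show ?case by unfold_locales (simp_all add: vec_eq_iff)
next
  case tau
  then show ?case by unfold_locales (simp_all add: tau_def vec_eq_iff algebra_simps)
next
  case iota
  then show ?case by unfold_locales (simp_all add: vec_eq_iff)
next
  case (comp g h)
  show ?case by (rule Vector_Spaces.linear_compose[OF comp.IH(2,1)])
qed

section \<open>The four-parameter family of cubics\<close>

lemma cubic_odd_eq: "cubic_odd p = cubic_even p \<circ> sigma"
  by (simp add: fun_eq_iff cubic_odd_def cubic_even_def)

lemma cubic_even_sym:
  "cubic_even p \<circ> tau = cubic_even p"
  "cubic_even p \<circ> iota = cubic_even p"
  by (simp_all add: fun_eq_iff cubic_even_def power2_eq_square power3_eq_cube rho_powers rho_rho_mult algebra_simps)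

lemma cubic_odd_sym:
  "cubic_odd p \<circ> tau = (\<lambda>x. - cubic_odd p x)"
  "cubic_odd p \<circ> iota = cubic_odd p"
  "cubic_odd p \<circ> sigma = cubic_even p"
  by (simp_all add: fun_eq_iff cubic_odd_def cubic_even_def power2_eq_square power3_eq_cube rho_powers rho_rho_mult algebra_simps)

lemma cubic_even_add: "cubic_even (p + q) = cubic_even p + cubic_even q"
  and cubic_even_scale: "cubic_even (c *s p) = (\<lambda>x. c * cubic_even p x)"
  by (simp_all add: fun_eq_iff cubic_even_def algebra_simps)

lemma form_closed:
  assumes "form.subspace V"
  shows "F \<in> V \<Longrightarrow> (\<lambda>x. c * F x) \<in> V" "F \<in> V \<Longrightarrow> G \<in> V \<Longrightarrow> (\<lambda>x. F x + G x) \<in> V"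
  using assms form.subspace_scale[of V F c] form.subspace_add[of V F G]
  by (simp_all add: plus_fun_def)

text \<open>
  Each of the four coefficients is isolated by a 0-1 vector: with the support \<open>{0}\<close> only the first
  bracket survives, and the supports \<open>{0, 2, 4}\<close>, \<open>{0, 3}\<close>, \<open>{1, 2, 3}\<close> each bring in one more.
\<close>

lemma cubic_even_eq_0: "cubic_even p = 0 \<Longrightarrow> p = 0"
proof -
  assume 0: "cubic_even p = 0"
  have ev: "cubic_even p x = 0" for x using 0 by simp
  show "p = 0"
   using ev[of "\<chi> i. if i = 0 then 1 else 0"]
    ev[of "\<chi> i. if i = 0 \<or> i = 2 \<or> i = 4 then 1 else 0"]
    ev[of "\<chi> i. if i = 0 \<or> i = 3 then 1 else 0"]
    ev[of "\<chi> i. if i = 1 \<or> i = 2 \<or> i = 3 then 1 else 0"]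
  by (simp add: cubic_even_def vec_eq_iff forall_4_from_0)
qed

lemma cubic_even_inj: "cubic_even p = cubic_even q \<Longrightarrow> p = q"
proof -
  assume "cubic_even p = cubic_even q"
  then have "cubic_even (p + (-1) *s q) = 0"
    unfolding cubic_even_add cubic_even_scale by (simp add: fun_eq_iff)
  then show "p = q" by (auto dest!: cubic_even_eq_0 simp: vec_eq_iff)
qed

lemma monomial_cubic: "(\<lambda>x. x $ i * x $ j * x $ k) \<in> cubic_forms"
  unfolding cubic_forms_def by (rule form.span_base) auto

lemma cubic_forms_subspace: "form.subspace cubic_forms"
  unfolding cubic_forms_def by simp

lemma cubic_even_in_cubic_forms: "cubic_even p \<in> cubic_forms"
  unfolding cubic_even_def power2_eq_square power3_eq_cube
  by (intro form_closed cubic_forms_subspace monomial_cubic)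

lemma cubic_odd_in_cubic_forms: "cubic_odd p \<in> cubic_forms"
  unfolding cubic_odd_def power2_eq_square power3_eq_cube
  by (intro form_closed cubic_forms_subspace monomial_cubic)

lemma cubic_homogeneous:
  assumes "F \<in> cubic_forms"
  shows "F (c *s x) = c ^ 3 * F x"
  using assms unfolding cubic_forms_def
  by (induction rule: form.span_induct_alt) (auto simp: algebra_simps power3_eq_cube)

section \<open>Cubic forms fixed by tau and by the square of sigma\<close>

lemma sum_powers_sixth_root:
  fixes z :: complex
  assumes "z ^ 6 = 1"
  shows "(\<Sum>n<6. z ^ n) = (if z = 1 then 6 else 0)"
  using assms by (simp add: geometric_sum)

text \<open>
  The projections of the space of cubic forms onto the forms fixed by \<open>tau\<close> and by \<open>sigma \<circ> sigma\<close>. The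
  images of the monomials under both in turn span the forms fixed by both.
\<close>

definition tau_avg :: "(complex ^ 6 \<Rightarrow> complex) \<Rightarrow> complex ^ 6 \<Rightarrow> complex" where
  "tau_avg F x = (\<Sum>n<6. F ((tau ^^ n) x)) / 6"

definition sigma2_avg :: "(complex ^ 6 \<Rightarrow> complex) \<Rightarrow> complex ^ 6 \<Rightarrow> complex" where
  "sigma2_avg F x = (F x + F (sigma (sigma x)) + F (sigma (sigma (sigma (sigma x))))) / 3"

text \<open>
  A monomial is an eigenvector of \<open>tau\<close> with eigenvalue \<open>weight (i + j + k)\<close>, which is 1 exactly if the
  indices add up to 0.
\<close>

lemma tau_avg_monomial:
  "tau_avg (\<lambda>x. x $ i * x $ j * x $ k) = (\<lambda>x. (if i + j + k = 0 then 1 else 0) * (x $ i * x $ j * x $ k))"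
proof
  fix x :: "complex ^ 6"
  have "(\<Sum>n<6. (tau ^^ n) x $ i * (tau ^^ n) x $ j * (tau ^^ n) x $ k)
      = (\<Sum>n<6. weight (i + j + k) ^ n) * (x $ i * x $ j * x $ k)"
    unfolding sum_distrib_right by (simp add: tau_funpow_weight weight_add power_mult_distrib ac_simps)
  then show "tau_avg (\<lambda>x. x $ i * x $ j * x $ k) x = (if i + j + k = 0 then 1 else 0) * (x $ i * x $ j * x $ k)"
    by (simp add: tau_avg_def sum_powers_sixth_root weight_power_6 weight_eq_1_iff)
qed

text \<open>
  Shifting all indices by 2 splits the ten monomials of index sum 0 into four orbits, those of
  \<open>x\<^sub>0\<^sup>3\<close>, \<open>x\<^sub>0 x\<^sub>2 x\<^sub>4\<close>, \<open>x\<^sub>0 x\<^sub>3\<^sup>2\<close> and \<open>x\<^sub>1 x\<^sub>2 x\<^sub>3\<close>. They are told apart by the coincidences among the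
  indices and by their parity, and each orbit sum is one of the four basic cubics.
\<close>

lemma sigma2_avg_monomial:
  fixes i j k :: 6
  assumes "i + j + k = 0"
  shows "\<exists>p. sigma2_avg (\<lambda>x. x $ i * x $ j * x $ k) = cubic_even p"
proof -
  \<comment> \<open>The factor 1/3 does not occur for \<open>x\<^sub>0 x\<^sub>2 x\<^sub>4\<close>, the one orbit consisting of a single monomial.\<close>
  define p :: "6 \<Rightarrow> 6 \<Rightarrow> 6 \<Rightarrow> complex ^ 4" where
   "p i j k = (if i = j \<and> j = k then axis 0 (1/3)
       else if i = j \<or> j = k \<or> i = k then axis 2 (1/3)
       else if i - j \<in> {2,4} \<and> j - k \<in> {2,4} then axis 1 1 else axis 3 (1/3))" for i j k
  have "\<forall>i j. sigma2_avg (\<lambda>x. x $ i * x $ j * x $ (- (i + j))) x = cubic_even (p i j (- (i + j))) x" for x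
    unfolding forall_6 p_def sigma2_avg_def cubic_even_def
    by (simp add: axis_def power2_eq_square power3_eq_cube add_divide_distrib)
       (intro conjI; simp add: ac_simps)
  moreover have "k = - (i + j)" using assms by (simp only: eq_neg_iff_add_eq_0 ac_simps)
  ultimately show ?thesis by (auto simp: fun_eq_iff)
qed

lemma cubic_form_average:
  assumes "F \<in> cubic_forms"
  shows "\<exists>p. sigma2_avg (tau_avg F) = cubic_even p"
  using assms unfolding cubic_forms_def
proof (induction rule: form.span_induct_alt)
  case base
  have "sigma2_avg (tau_avg 0) = cubic_even 0"
    by (simp add: fun_eq_iff sigma2_avg_def tau_avg_def cubic_even_def)
  then show ?case by blast
next
  case (step c M F)
  from step(1) obtain i j k where M: "M = (\<lambda>x. x $ i * x $ j * x $ k)" by auto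
  have "\<exists>p. sigma2_avg (tau_avg M) = cubic_even p"
  proof (cases "i + j + k = 0")
    case True
    then show ?thesis using sigma2_avg_monomial[of i j k] unfolding M tau_avg_monomial by simp
  next
    case False
    then have "sigma2_avg (tau_avg M) = cubic_even 0" unfolding M tau_avg_monomial
      by (simp add: fun_eq_iff sigma2_avg_def cubic_even_def)
    then show ?thesis by blast
  qed
  then obtain p where p: "sigma2_avg (tau_avg M) = cubic_even p" ..
  obtain q where q: "sigma2_avg (tau_avg F) = cubic_even q" using step.IH ..
  have "sigma2_avg (tau_avg ((\<lambda>x. c * M x) + F)) = (\<lambda>x. c * sigma2_avg (tau_avg M) x) + sigma2_avg (tau_avg F)"
    by (simp add: fun_eq_iff sigma2_avg_def tau_avg_def sum.distrib sum_distrib_left[symmetric] field_simps)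
  also have "\<dots> = cubic_even (c *s p + q)"
    unfolding p q cubic_even_add cubic_even_scale ..
  finally show ?case by blast
qed

lemma invariant_cubic_form:
  assumes F: "F \<in> cubic_forms" and tau: "F \<circ> tau = F" and sigma: "F \<circ> sigma \<circ> sigma = F"
  obtains p where "F = cubic_even p"
proof -
  have t: "F (tau x) = F x" and s: "F (sigma (sigma x)) = F x" for x
    using tau sigma by (auto simp: fun_eq_iff)
  have "F ((tau ^^ n) x) = F x" for n x by (induction n) (simp_all add: t)
  then have "tau_avg F = F" by (simp add: fun_eq_iff tau_avg_def)
  moreover have "sigma2_avg F = F" by (simp add: fun_eq_iff sigma2_avg_def s)
  ultimately show thesis using cubic_form_average[OF F] that by auto
qed

section \<open>Classification of the invariant pencils\<close>

lemma in_span_pair_iff: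
  "H \<in> form.span {F, G} \<longleftrightarrow> (\<exists>a b. H = (\<lambda>x. a * F x + b * G x))"
proof -
  have "H \<in> form.span {F, G} \<longleftrightarrow> (\<exists>a b. H = (\<lambda>x. a * F x) + (\<lambda>x. b * G x))"
    by (auto simp: form.span_insert form.span_singleton algebra_simps)
  then show ?thesis by (simp add: plus_fun_def)
qed

text \<open>
  Comparing the relation at \<open>x\<close> and at \<open>tau x\<close> gives the sum and the difference of the two terms.
\<close>

lemma opposite_eigenfunctions_coeff:
  assumes F: "\<And>x. F (tau x) = c * F x" and G: "\<And>x. G (tau x) = - c * G x"
    and nz: "c \<noteq> 0" "F \<noteq> 0" "G \<noteq> 0"
    and 0: "\<And>x. a * F x + b * G x = (0::complex)"
  shows "a = 0 \<and> b = 0"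
proof -
  have "a * F x = 0 \<and> b * G x = 0" for x
  proof -
    have "c * (a * F x - b * G x) = 0" using 0[of "tau x"] by (simp add: F G algebra_simps)
    with \<open>c \<noteq> 0\<close> have "a * F x = b * G x" by simp
    with 0[of x] show ?thesis by simp
  qed
  with nz show ?thesis by (auto simp: fun_eq_iff)
qed

lemma opposite_eigenfunctions_independent:
  assumes F: "\<And>x. F (tau x) = c * F x" and G: "\<And>x. G (tau x) = - c * G x"
    and nz: "c \<noteq> 0" "F \<noteq> 0" "G \<noteq> 0"
  shows "form.independent {F, G}" "F \<noteq> G"
proof -
  note coeff = opposite_eigenfunctions_coeff[OF F G nz]
  have "F \<notin> form.span {G}"
  proof
    assume "F \<in> form.span {G}"
    then obtain k where "F = (\<lambda>x. k * G x)" by (auto simp: form.span_singleton)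
    then have "1 * F x + (- k) * G x = 0" for x by simp
    from coeff[OF this] show False by simp
  qed
  then show "form.independent {F, G}" "F \<noteq> G"
    using \<open>G \<noteq> 0\<close> by (auto simp: form.independent_insert form.span_base)
qed

text \<open>
  An independent pair in \<open>V\<close> extends to a basis of \<open>V\<close>, which has two elements and so is the pair itself.
\<close>

lemma dim_2_eq_span:
  assumes V: "form.subspace V" "form.dim V = 2"
    and FG: "F \<in> V" "G \<in> V" "form.independent {F, G}" "F \<noteq> G"
  shows "V = form.span {F, G}"
proof
  show "form.span {F, G} \<subseteq> V" using FG V by (intro form.span_minimal) auto
  obtain B where B: "{F, G} \<subseteq> B" "B \<subseteq> V" "form.independent B" "V \<subseteq> form.span B"
    using form.maximal_independent_subset_extend[of "{F, G}" V] FG by auto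
  then have "card B = 2" using form.basis_card_eq_dim V by metis
  then have "{F, G} = B"
    using B FG by (intro card_subset_eq) (auto intro: card_ge_0_finite)
  with B show "V \<subseteq> form.span {F, G}" by simp
qed

definition pencil :: "complex ^ 4 \<Rightarrow> (complex ^ 6 \<Rightarrow> complex) set" where
  "pencil p = form.span {cubic_even p, cubic_odd p}"

lemma cubic_odd_eq_0: "cubic_odd p = 0 \<Longrightarrow> p = 0"
  using cubic_odd_sym(3)[of p] by (intro cubic_even_eq_0) (auto simp: fun_eq_iff)

text \<open>
  The factors 1 give the two equations the shape of the hypotheses on opposite eigenfunctions.
\<close>

lemma cubic_tau: "cubic_even p (tau x) = 1 * cubic_even p x" "cubic_odd p (tau x) = - 1 * cubic_odd p x"
  using cubic_even_sym(1)[of p] cubic_odd_sym(1)[of p] by (auto simp: fun_eq_iff)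

lemma pencil_invariant:
  assumes "p \<noteq> 0"
  shows "pencil p \<in> G6_invariant_pencils"
proof -
  have nz: "cubic_even p \<noteq> 0" "cubic_odd p \<noteq> 0"
    using cubic_even_eq_0 cubic_odd_eq_0 assms by auto
  note ind = opposite_eigenfunctions_independent[OF cubic_tau one_neq_zero nz]
  have dim: "form.dim (pencil p) = 2"
    unfolding pencil_def using form.dim_span_eq_card_independent[OF ind(1)] ind(2) by simp
  have cub: "pencil p \<subseteq> cubic_forms"
    unfolding pencil_def
    by (intro form.span_minimal cubic_forms_subspace)
       (simp add: cubic_even_in_cubic_forms cubic_odd_in_cubic_forms)
  have closed: "\<forall>F\<in>pencil p. F \<circ> g \<in> pencil p"
    if g: "\<And>a b. \<exists>a' b'. (\<lambda>x. a * cubic_even p x + b * cubic_odd p x) \<circ> g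
      = (\<lambda>x. a' * cubic_even p x + b' * cubic_odd p x)" for g
  proof
    fix F assume "F \<in> pencil p"
    then obtain a b where F: "F = (\<lambda>x. a * cubic_even p x + b * cubic_odd p x)"
      unfolding pencil_def in_span_pair_iff by blast
    show "F \<circ> g \<in> pencil p" unfolding pencil_def in_span_pair_iff unfolding F by (rule g)
  qed
  have "\<forall>F\<in>pencil p. F \<circ> g \<in> pencil p" if "g \<in> carrier G6" for g
    using that
  proof (induction rule: G6_induct)
    case (comp g h)
    then show ?case by (metis comp_assoc)
  next
    case id
    then show ?case by simp
  next
    case sigma
    have "(\<lambda>x. a * cubic_even p x + b * cubic_odd p x) \<circ> sigma = (\<lambda>x. b * cubic_even p x + a * cubic_odd p x)" for a b
      using cubic_odd_eq[of p] cubic_odd_sym(3)[of p] by (simp add: fun_eq_iff)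
    then show ?case by (intro closed) blast
  next
    case tau
    have "(\<lambda>x. a * cubic_even p x + b * cubic_odd p x) \<circ> tau = (\<lambda>x. a * cubic_even p x + (-b) * cubic_odd p x)" for a b
      using cubic_tau[of p] by (simp add: fun_eq_iff)
    then show ?case by (intro closed) blast
  next
    case iota
    have "(\<lambda>x. a * cubic_even p x + b * cubic_odd p x) \<circ> iota = (\<lambda>x. a * cubic_even p x + b * cubic_odd p x)" for a b
      using cubic_even_sym(2)[of p] cubic_odd_sym(2)[of p] by (simp add: fun_eq_iff)
    then show ?case by (intro closed) blast
  qed
  with dim cub show ?thesis unfolding G6_invariant_pencils_def by (simp add: pencil_def)
qed

lemma sum_fun_apply: "(\<Sum>n\<in>A. f n) x = (\<Sum>n\<in>A. f n x :: complex)"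
  by (induction A rule: infinite_finite_induct) simp_all

text \<open>
  Since \<open>tau\<close> has order 6, its action is diagonalised by the discrete Fourier transform: \<open>6 F\<close> is the sum
  of the six functions \<open>G k\<close> below, each of which is zero or an eigenfunction.
\<close>

lemma tau_eigenfunction_exists:
  assumes V: "form.subspace V" and inv: "\<And>F. F \<in> V \<Longrightarrow> F \<circ> tau \<in> V"
    and F: "F \<in> V" "F \<noteq> 0"
  obtains G c where "G \<in> V" "G \<noteq> 0" "\<And>x. G (tau x) = c * G x" "c ^ 6 = (1::complex)"
proof -
  define G where "G k x = (\<Sum>n<6. (rho ^ k) ^ n * F ((tau ^^ n) x))" for k :: nat and x
  have GV: "G k \<in> V" for k
  proof -
    have "F \<circ> tau ^^ n \<in> V" for n
    proof (induction n)
      case (Suc n)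
      then show ?case using inv[OF Suc] by (simp only: funpow_Suc_right comp_assoc)
    qed (use F in simp)
    then have "(\<Sum>n<6. (\<lambda>x. (rho ^ k) ^ n * (F \<circ> tau ^^ n) x)) \<in> V"
      by (intro form.subspace_sum V form_closed(1)[OF V])
    also have "(\<Sum>n<6. (\<lambda>x. (rho ^ k) ^ n * (F \<circ> tau ^^ n) x)) = G k"
      by (simp add: fun_eq_iff G_def sum_fun_apply)
    finally show ?thesis .
  qed
  have eig: "rho ^ k * G k (tau x) = G k x" for k x
  proof -
    let ?f = "\<lambda>n. (rho ^ k) ^ n * F ((tau ^^ n) x)"
    have "rho ^ k * G k (tau x) = (\<Sum>n<6. ?f (Suc n))"
      unfolding G_def sum_distrib_left by (simp add: funpow_swap1 mult.assoc)
    moreover have "(\<Sum>n<Suc 6. ?f n) = ?f 0 + (\<Sum>n<6. ?f (Suc n))" by (rule sum.lessThan_Suc_shift)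
    moreover have "(\<Sum>n<Suc 6. ?f n) = (\<Sum>n<6. ?f n) + ?f 6" by (rule sum.lessThan_Suc)
    moreover have "?f 6 = ?f 0"
      using rho_root(2) by (simp add: tau_6 mult.commute[of k] power_mult flip: power_mult[of rho k 6])
    ultimately show ?thesis by (simp add: G_def)
  qed
  have "(\<Sum>k<6. G k x) = 6 * F x" for x
  proof -
    have rho: "(\<Sum>k<6. (rho ^ n) ^ k) = (if n = 0 then 6 else 0)" if "n < 6" for n
    proof -
      have r6: "(rho ^ n) ^ 6 = 1" using rho_root(2) by (metis power_mult mult.commute power_one)
      have "n \<in> {0, 1, 2, 3, 4, 5}" using that by auto
      then have "rho ^ n = weight (of_nat n) \<and> (of_nat n = (0::6) \<longleftrightarrow> n = 0)"
        by (auto simp: bit0.Rep_inject_sym bit0.Rep_numeral bit0.Rep_0 bit0.Rep_1)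
      then show ?thesis using r6 by (simp add: sum_powers_sixth_root weight_eq_1_iff)
    qed
    have "(\<Sum>k<6. G k x) = (\<Sum>n<6. (\<Sum>k<6. (rho ^ n) ^ k) * F ((tau ^^ n) x))"
      unfolding G_def sum_distrib_right by (subst sum.swap) (simp add: mult.commute flip: power_mult)
    also have "\<dots> = (\<Sum>n<(6::nat). if n = 0 then 6 * F x else 0)"
      by (intro sum.cong) (auto simp: rho)
    also have "\<dots> = 6 * F x" by (simp add: sum.delta)
    finally show ?thesis .
  qed
  moreover obtain x where "F x \<noteq> 0" using F(2) by (auto simp: fun_eq_iff)
  ultimately obtain k where "G k x \<noteq> 0"
    by (metis (no_types, lifting) mult_eq_0_iff sum.neutral zero_neq_numeral)
  then have "G k \<noteq> 0" by (auto simp: fun_eq_iff)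
  moreover have "G k (tau x) = (1 / rho ^ k) * G k x" for x
    using eig[of k x] rho_root(3) by (simp add: field_simps)
  moreover have "(1 / rho ^ k) ^ 6 = 1"
    using rho_root(2) by (metis power_one_over power_mult mult.commute power_one div_by_1)
  ultimately show thesis using that GV by blast
qed

lemma comp_surj_eq_0:
  assumes "surj g" "(F :: complex ^ 6 \<Rightarrow> complex) \<circ> g = 0"
  shows "F = 0"
  using assms by (metis comp_apply surjD ext zero_fun_apply)

text \<open>
  The scalar \<open>rho\<close> in the commutation relation becomes \<open>rho\<^sup>3 = -1\<close> on forms of degree 3.
\<close>

lemma sigma_negates_tau_eigenvalue:
  assumes F: "F \<in> cubic_forms" "\<And>x. F (tau x) = c * F x"
  shows "(F \<circ> sigma) (tau x) = - c * (F \<circ> sigma) x"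
  using cubic_homogeneous[OF F(1)] by (simp add: generator_relations F(2) rho_powers)

lemma invariant_pencil_span:
  assumes V: "V \<in> G6_invariant_pencils"
    and G: "G \<in> V" "G \<noteq> 0" "\<And>x. G (tau x) = c * G x" "c \<noteq> 0"
  shows "V = form.span {G, G \<circ> sigma}"
    and "G \<circ> sigma \<in> V" and "G \<circ> sigma \<noteq> 0"
    and "\<And>x. (G \<circ> sigma) (tau x) = - c * (G \<circ> sigma) x"
proof -
  from V have V': "form.subspace V" "V \<subseteq> cubic_forms" "form.dim V = 2"
    and inv: "\<And>g F. g \<in> carrier G6 \<Longrightarrow> F \<in> V \<Longrightarrow> F \<circ> g \<in> V"
    by (auto simp: G6_invariant_pencils_def)
  show S: "G \<circ> sigma \<in> V" by (intro inv G6_closed G)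
  show nz: "G \<circ> sigma \<noteq> 0" using comp_surj_eq_0[of sigma G] bij_gens(1) G(2) by (auto simp: bij_def)
  show eig: "(G \<circ> sigma) (tau x) = - c * (G \<circ> sigma) x" for x
    using V' G by (intro sigma_negates_tau_eigenvalue) auto
  show "V = form.span {G, G \<circ> sigma}"
    using opposite_eigenfunctions_independent[OF G(3) eig G(4,2) nz] V' G(1) S
    by (intro dim_2_eq_span) auto
qed

text \<open>
  Start from an eigenform \<open>G\<close> of \<open>tau\<close> with eigenvalue \<open>c\<close>. The form \<open>G \<circ> iota\<close> has eigenvalue \<open>1 / c\<close>, but
  only \<open>c\<close> and \<open>- c\<close> occur in the pencil, whence \<open>c\<^sup>2 = 1\<close> or \<open>c\<^sup>2 = -1\<close>. The second case contradicts
  \<open>c\<^sup>6 = 1\<close>. In the first, \<open>G\<close> or \<open>G \<circ> sigma\<close> is fixed.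
\<close>

lemma invariant_pencil_fixed_form:
  assumes V: "V \<in> G6_invariant_pencils"
  obtains E where "E \<in> V" "E \<noteq> 0" "E \<circ> tau = E"
proof -
  from V have V': "form.subspace V" "V \<subseteq> cubic_forms" "form.dim V = 2"
    and inv: "\<And>g F. g \<in> carrier G6 \<Longrightarrow> F \<in> V \<Longrightarrow> F \<circ> g \<in> V"
    by (auto simp: G6_invariant_pencils_def)
  have "\<exists>F\<in>V. F \<noteq> 0"
  proof (rule ccontr)
    assume "\<not> ?thesis"
    then have "V \<subseteq> form.span {}" by auto
    then have "form.dim V \<le> card ({} :: (complex ^ 6 \<Rightarrow> complex) set)" by (rule form.dim_le_card) simp
    with V' show False by simp
  qed
  then obtain F where F: "F \<in> V" "F \<noteq> 0" by blast
  obtain G c where G: "G \<in> V" "G \<noteq> 0" "\<And>x. G (tau x) = c * G x" and c6: "c ^ 6 = 1"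
    using tau_eigenfunction_exists[OF V'(1) inv[OF G6_closed(3)] F] by blast
  have c0: "c \<noteq> 0" using c6 by auto
  note S = invariant_pencil_span[OF V G c0]
  have "G \<circ> iota \<in> V" by (intro inv G6_closed G)
  then have "G \<circ> iota \<in> form.span {G, G \<circ> sigma}" using S(1) by simp
  then obtain a b where ab: "G \<circ> iota = (\<lambda>x. a * G x + b * (G \<circ> sigma) x)"
    unfolding in_span_pair_iff by blast
  then have ab: "G (iota x) = a * G x + b * (G \<circ> sigma) x" for x by (simp add: fun_eq_iff)
  have Gi: "c * G (iota (tau x)) = G (iota x)" for x
    using G(3)[of "iota (tau x)"] by (simp add: generator_relations)
  \<comment> \<open>Substituting the expansion of \<open>G \<circ> iota\<close> on both sides of \<open>Gi\<close>.\<close>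
  have "(c * c - 1) * a * G x + (- (c * c) - 1) * b * (G \<circ> sigma) x = 0" for x
    using Gi[of x] unfolding ab S(4) G(3) by (simp add: algebra_simps)
  from opposite_eigenfunctions_coeff[OF G(3) S(4) c0 G(2) S(3) this]
  have *: "(c * c = 1 \<or> a = 0) \<and> (- (c * c) = 1 \<or> b = 0)" by auto
  have "\<not> (a = 0 \<and> b = 0)"
  proof
    assume "a = 0 \<and> b = 0"
    then have "G \<circ> iota = 0" using ab by (simp add: fun_eq_iff)
    then show False using comp_surj_eq_0[of iota G] bij_gens(3) G(2) by (auto simp: bij_def)
  qed
  moreover have "- (c * c) \<noteq> 1"
  proof
    assume "- (c * c) = 1"
    then have "c * c = -1" by (simp add: minus_equation_iff)
    moreover have "c ^ 6 = (c * c) ^ 3" by (simp add: eval_nat_numeral)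
    ultimately show False using c6 by simp
  qed
  ultimately have "c * c = 1" using * by auto
  then have "c = 1 \<or> c = -1" using square_eq_1_iff by blast
  then show thesis
  proof
    assume "c = 1"
    with G that show thesis by (auto simp: fun_eq_iff)
  next
    assume "c = -1"
    with S that show thesis by (auto simp: fun_eq_iff)
  qed
qed

text \<open>
  The \<open>tau\<close>-fixed forms of the pencil are the multiples of a single form \<open>E\<close>. Both \<open>sigma \<circ> sigma\<close> and \<open>iota\<close>
  preserve this line, acting by scalars \<open>a\<close> and \<open>d\<close>. As \<open>iota\<close> conjugates \<open>sigma \<circ> sigma\<close> to its inverse,
  \<open>a\<^sup>2 = 1\<close>, and \<open>a\<^sup>3 = 1\<close> because \<open>sigma\<close> has order 6. So \<open>a = 1\<close>, and the averaging argument applies to \<open>E\<close>.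
\<close>

theorem invariant_pencil_classification:
  assumes V: "V \<in> G6_invariant_pencils"
  obtains p where "p \<noteq> 0" "V = pencil p"
proof -
  from V have V': "form.subspace V" "V \<subseteq> cubic_forms" "form.dim V = 2"
    and inv: "\<And>g F. g \<in> carrier G6 \<Longrightarrow> F \<in> V \<Longrightarrow> F \<circ> g \<in> V"
    by (auto simp: G6_invariant_pencils_def)
  obtain E where E: "E \<in> V" "E \<noteq> 0" "E \<circ> tau = E" using invariant_pencil_fixed_form[OF V] .
  then have Et: "E (tau x) = 1 * E x" for x by (simp add: fun_eq_iff)
  note S = invariant_pencil_span[OF V E(1,2) Et one_neq_zero]
  have fixed: "\<exists>a. \<forall>x. H x = a * E x" if H: "H \<in> V" "\<And>x. H (tau x) = H x" for H
  proof -
    from H(1) have "H \<in> form.span {E, E \<circ> sigma}" using S(1) by simp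
    then obtain a b where ab: "H = (\<lambda>x. a * E x + b * (E \<circ> sigma) x)"
      unfolding in_span_pair_iff by blast
    \<comment> \<open>The difference of \<open>H x\<close> and \<open>H (tau x)\<close>.\<close>
    have "0 * E x + (2 * b) * (E \<circ> sigma) x = 0" for x
      using H(2)[of x] unfolding ab S(4) Et by simp
    from opposite_eigenfunctions_coeff[OF Et S(4) one_neq_zero E(2) S(3) this]
    have "b = 0" by simp
    with ab show ?thesis by auto
  qed
  have "E \<circ> sigma \<circ> sigma \<in> V" by (intro inv G6_closed S)
  moreover have "(E \<circ> sigma \<circ> sigma) (tau x) = (E \<circ> sigma \<circ> sigma) x" for x
    using sigma_negates_tau_eigenvalue[of "E \<circ> sigma" "-1" x] S(2,4) V'(2) by auto
  ultimately obtain a where "\<forall>x. (E \<circ> sigma \<circ> sigma) x = a * E x" using fixed by blast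
  then have a: "E (sigma (sigma x)) = a * E x" for x by simp
  have "E \<circ> iota \<in> V" by (intro inv G6_closed E)
  moreover have "(E \<circ> iota) (tau x) = (E \<circ> iota) x" for x
    using Et[of "iota (tau x)"] by (simp add: generator_relations)
  ultimately obtain d where "\<forall>x. (E \<circ> iota) x = d * E x" using fixed by blast
  then have d: "E (iota x) = d * E x" for x by simp
  obtain x where x: "E x \<noteq> 0" using E(2) by (auto simp: fun_eq_iff)
  have "d * (d * E x) = E x" using d[of "iota x"] by (simp add: d iota_2)
  then have d0: "d \<noteq> 0" using x by auto
  have "E (iota x) = E (sigma (sigma (iota (sigma (sigma x)))))"
    by (simp add: generator_relations)
  also have "\<dots> = a * (d * (a * E x))" unfolding a d ..
  finally have "(a * a) * (d * E x) = 1 * (d * E x)" by (simp add: d mult_ac)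
  then have a2: "a * a = 1" unfolding mult_right_cancel[of "d * E x"] using d0 x by simp
  have "E x = E ((sigma ^^ 6) x)" by (simp add: sigma_6)
  also have "\<dots> = a * (a * a) * E x" by (simp add: eval_nat_numeral a)
  finally have "a = 1" using a2 x by simp
  then have "E \<circ> sigma \<circ> sigma = E" using a by (simp add: fun_eq_iff)
  then obtain p where p: "E = cubic_even p"
    using invariant_cubic_form[of E] E V'(2) by blast
  then have "p \<noteq> 0" using E(2) by (auto simp: cubic_even_def fun_eq_iff)
  moreover have "V = pencil p" unfolding pencil_def S(1) cubic_odd_eq p ..
  ultimately show thesis by (rule that)
qed

section \<open>Points, lines and the action on them\<close>

lemma proj_point_span: "x \<noteq> 0 \<Longrightarrow> vec.span {x} \<in> proj_points"
  by (simp add: proj_points_def vec.dim_span)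

lemma proj_pointE:
  assumes "P \<in> proj_points"
  obtains x where "x \<noteq> 0" "P = vec.span {x}"
proof -
  have P: "vec.subspace P" "vec.dim P = 1" using assms by (auto simp: proj_points_def)
  then have "\<not> P \<subseteq> {0}" by (metis vec.dim_eq_0 zero_neq_one)
  then obtain x where x: "x \<in> P" "x \<noteq> 0" by auto
  have "vec.span {x} = P"
    using P x by (intro vec.subspace_dim_equal vec.span_minimal) (auto simp: vec.dim_span)
  with x that show thesis by auto
qed

lemma proj_lineE:
  assumes "L \<in> proj_lines"
  obtains W where "vec.subspace W" "vec.dim W = 2" "L = {P \<in> proj_points. P \<subseteq> W}" "\<Union>L = W"
proof -
  obtain W where W: "vec.subspace W" "vec.dim W = 2" and L: "L = {P \<in> proj_points. P \<subseteq> W}"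
    using assms by (auto simp: proj_lines_def)
  have span: "vec.span {x} \<in> L" if "x \<in> W" "x \<noteq> 0" for x
    using that W proj_point_span[of x] unfolding L by (auto intro: vec.span_minimal[THEN subsetD])
  have "\<not> W \<subseteq> {0}" using W(2) by (metis vec.dim_eq_0 zero_neq_numeral)
  then obtain y where y: "y \<in> W" "y \<noteq> 0" by auto
  have "x \<in> \<Union>L" if "x \<in> W" for x
  proof (cases "x = 0")
    case True
    then show ?thesis using span[OF y] vec.span_zero by blast
  next
    case False
    then show ?thesis using span[OF that False] vec.span_base[of x "{x}"] by blast
  qed
  then have "\<Union>L = W" unfolding L by blast
  with W L that show thesis by blast
qed

lemma act_line_comp: "act_line g (act_line h L) = act_line (g \<circ> h) L"
  by (simp add: act_line_def image_comp comp_def image_image)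

lemma act_line_id: "act_line id L = L"
  by (simp add: act_line_def)

lemma Union_act_line: "\<Union>(act_line g L) = g ` \<Union>L"
  by (auto simp: act_line_def)

lemma act_line_inj: "inj g \<Longrightarrow> act_line g L = act_line g L' \<Longrightarrow> L = L'"
  unfolding act_line_def by (metis inj_image_eq_iff inj_onI)

lemma G6_image_proj_point:
  assumes "g \<in> carrier G6" "P \<in> proj_points"
  shows "g ` P \<in> proj_points"
proof -
  have lin: "Vector_Spaces.linear (*s) (*s) g" and "inj g"
    using G6_linear G6_closed(7) assms by (auto simp: bij_def)
  then have "vec.dim (g ` P) = vec.dim P"
    by (intro vec.dim_image_eq) (auto intro: inj_on_subset)
  with assms(2) lin show ?thesis by (simp add: proj_points_def vec.linear_subspace_image)
qed

text \<open>
  On the points of a line the scalar in the commutation relation is invisible.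
\<close>

lemma act_line_commute:
  assumes "L \<subseteq> proj_points"
  shows "act_line sigma (act_line tau L) = act_line tau (act_line sigma L)"
proof -
  have "(sigma \<circ> tau) ` P = (tau \<circ> sigma) ` P" if "P \<in> L" for P
  proof -
    have P: "vec.subspace P" using that assms by (auto simp: proj_points_def)
    have lin: "rho *s tau (sigma x) = tau (sigma (rho *s x))" for x
      by (simp add: tau_def vec_eq_iff algebra_simps)
    have 1: "(sigma \<circ> tau) x = (tau \<circ> sigma) (rho *s x)" for x
      by (simp add: generator_relations lin)
    have 2: "(tau \<circ> sigma) x = (sigma \<circ> tau) ((1 / rho) *s x)" for x
      unfolding 1 using rho_root(3) by simp
    have "(1 / rho) *s x \<in> P" "rho *s x \<in> P" if "x \<in> P" for x
      using P that by (auto intro: vec.subspace_scale)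
    with 1 2 show ?thesis by blast
  qed
  then show ?thesis unfolding act_line_comp unfolding act_line_def by auto
qed

section \<open>Orbits of three lines\<close>

text \<open>
  If \<open>s\<close> exchanged two elements, it would have to fix the third; hence \<open>s\<close> is a 3-cycle.
\<close>

lemma fixed_point_free_on_3:
  assumes card: "card X = 3" and inj: "inj_on s X" and maps: "s ` X \<subseteq> X"
    and free: "\<And>y. y \<in> X \<Longrightarrow> s y \<noteq> y" and x: "x \<in> X"
  shows "X = {x, s x, s (s x)}" "s (s (s x)) = x"
proof -
  have fin: "finite X" using card by (intro card_ge_0_finite) simp
  have in_X: "s x \<in> X" "s (s x) \<in> X" "s (s (s x)) \<in> X" using maps x by auto
  have "s (s x) \<noteq> x"
  proof
    assume 2: "s (s x) = x"
    have "card (X - {x, s x}) = 1"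
      using card free[OF x] x in_X fin by (subst card_Diff_subset) auto
    then obtain y where y: "X - {x, s x} = {y}" by (auto simp: card_1_singleton_iff)
    then have "y \<in> X" "y \<noteq> x" "y \<noteq> s x" by auto
    moreover from this have "s y \<noteq> s x" "s y \<noteq> s (s x)" using inj in_X x by (auto dest: inj_onD)
    ultimately have "s y \<in> X - {x, s x}" using maps 2 by auto
    with y free[OF \<open>y \<in> X\<close>] show False by auto
  qed
  then have d: "card {x, s x, s (s x)} = 3" using free[OF x] free[OF in_X(1)] by (auto simp: card_insert_if)
  show X: "X = {x, s x, s (s x)}"
    using d card fin in_X x by (intro card_subset_eq[symmetric]) auto
  have "s (s (s x)) \<noteq> s x" using \<open>s (s x) \<noteq> x\<close> inj in_X x by (auto dest: inj_onD)
  moreover have "s (s (s x)) \<noteq> s (s x)" using free[OF in_X(2)] .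
  ultimately show "s (s (s x)) = x" using X in_X by auto
qed

text \<open>
  A permutation of three elements other than the identity has at most one fixed point. If \<open>s\<close> has exactly
  one, then \<open>t\<close>, commuting with \<open>s\<close>, fixes it too.
\<close>

lemma commuting_on_3:
  assumes card: "card X = 3" and s: "inj_on s X" "s ` X \<subseteq> X" and t: "inj_on t X" "t ` X \<subseteq> X"
    and comm: "\<And>y. y \<in> X \<Longrightarrow> s (t y) = t (s y)"
    and nofix: "\<And>y. y \<in> X \<Longrightarrow> s y = y \<Longrightarrow> t y = y \<Longrightarrow> False"
  shows "(\<forall>y\<in>X. s y = y) \<or> (\<forall>y\<in>X. s y \<noteq> y)"
proof (rule ccontr)
  assume "\<not> ?thesis"
  then obtain y w where y: "y \<in> X" "s y = y" and w: "w \<in> X" "s w \<noteq> w" by blast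
  have ty: "t y \<in> X" "s (t y) = t y" "t y \<noteq> y" using comm[OF y(1)] y t(2) nofix[OF y] by auto
  have ne: "w \<noteq> y" "w \<noteq> t y" using y ty w by auto
  have "card {y, t y, w} = 3" using ne ty by auto
  then have X: "{y, t y, w} = X"
    using card y ty w by (intro card_subset_eq) (auto intro: card_ge_0_finite)
  have "s w \<in> X" using s(2) w by auto
  moreover have "s w \<noteq> y" using inj_onD[OF s(1), of w y] y w ne by auto
  moreover have "s w \<noteq> t y" using inj_onD[OF s(1), of w "t y"] ty w ne by auto
  ultimately show False using X w by auto
qed

lemma order_3_on_3:
  assumes "card X = 3" "inj_on s X" "s ` X \<subseteq> X" "x \<in> X"
    and "(\<forall>y\<in>X. s y = y) \<or> (\<forall>y\<in>X. s y \<noteq> y)"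
  shows "s (s (s x)) = x"
  using fixed_point_free_on_3(2)[of X s x] assms by auto

locale three_line_orbit =
  fixes \<L> :: "(complex ^ 6) set set set" and L
  assumes line: "L \<in> proj_lines" and orbit: "\<L> = {act_line g L | g. g \<in> carrier G6}"
    and card: "card \<L> = 3"
begin

lemma act_closed: "g \<in> carrier G6 \<Longrightarrow> L' \<in> \<L> \<Longrightarrow> act_line g L' \<in> \<L>"
  unfolding orbit using G6_closed(5) act_line_comp by blast

lemma points: "L' \<in> \<L> \<Longrightarrow> L' \<subseteq> proj_points"
proof
  fix P assume "L' \<in> \<L>" "P \<in> L'"
  then obtain g Q where "g \<in> carrier G6" "Q \<in> L" "P = g ` Q" unfolding orbit act_line_def by blast
  moreover have "L \<subseteq> proj_points" using line unfolding proj_lines_def by blast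
  ultimately show "P \<in> proj_points" using G6_image_proj_point by blast
qed

lemma L_in: "L \<in> \<L>"
  unfolding orbit using G6_closed(1) act_line_id[of L, symmetric] by blast

text \<open>
  A line \<open>L0\<close> fixed by \<open>sigma\<close> and \<open>tau\<close> would lie in the orbit \<open>{L0, iota L0}\<close>: both generators fix
  \<open>iota L0\<close> as well, because \<open>iota\<close> normalises the group they generate.
\<close>

lemma no_fixed_line:
  assumes "L0 \<in> \<L>" "act_line sigma L0 = L0" "act_line tau L0 = L0"
  shows False
proof -
  let ?S = "{L0, act_line iota L0}"
  have comm: "act_line g (act_line iota L0) = act_line iota L0"
    if "g \<circ> iota \<circ> g = iota" "act_line g L0 = L0" for g
  proof -
    have "act_line g (act_line iota L0) = act_line g (act_line iota (act_line g L0))" by (simp add: that)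
    also have "\<dots> = act_line (g \<circ> iota \<circ> g) L0" by (simp only: act_line_comp comp_assoc)
    finally show ?thesis by (simp only: that)
  qed
  have stable: "\<forall>L'\<in>?S. act_line g L' \<in> ?S" if "g \<in> carrier G6" for g
    using that
  proof (induction rule: G6_induct)
    case id
    show ?case unfolding act_line_id by blast
  next
    case sigma
    have "sigma \<circ> iota \<circ> sigma = iota" by (simp add: fun_eq_iff generator_relations)
    from comm[OF this assms(2)] show ?case by (simp add: assms(2))
  next
    case tau
    have "tau \<circ> iota \<circ> tau = iota" by (simp add: fun_eq_iff generator_relations)
    from comm[OF this assms(3)] show ?case by (simp add: assms(3))
  next
    case iota
    have "act_line iota (act_line iota L0) = L0"
    proof -
      have "iota \<circ> iota = id" by (simp add: fun_eq_iff iota_2)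
      then show ?thesis unfolding act_line_comp by (simp only: act_line_id)
    qed
    then show ?case by auto
  next
    case (comp g h)
    show ?case unfolding act_line_comp[symmetric] using comp.IH by blast
  qed
  obtain g0 where g0: "g0 \<in> carrier G6" "L0 = act_line g0 L" using assms(1) unfolding orbit by blast
  have "\<L> \<subseteq> ?S"
  proof
    fix L' assume "L' \<in> \<L>"
    then obtain h where h: "h \<in> carrier G6" "L' = act_line h L" unfolding orbit by blast
    have "(h \<circ> inv_into UNIV g0) \<circ> g0 = h"
      using G6_closed(7)[OF g0(1)] by (simp add: comp_assoc bij_def inj_iff)
    then have "L' = act_line (h \<circ> inv_into UNIV g0) L0"
      unfolding g0(2) act_line_comp h(2) by simp
    then show "L' \<in> ?S" using stable[OF G6_closed(5)[OF h(1) G6_closed(6)[OF g0(1)]]] by blast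
  qed
  then have "card \<L> \<le> card ?S" by (intro card_mono) auto
  also have "\<dots> \<le> 2" by (simp add: card_insert_if)
  finally show False using card by simp
qed

lemma act_permutes:
  assumes "g \<in> carrier G6"
  shows "inj_on (act_line g) \<L>" "act_line g ` \<L> \<subseteq> \<L>"
proof -
  show "inj_on (act_line g) \<L>"
    using G6_closed(7)[OF assms] act_line_inj[of g] by (intro inj_onI) (simp add: bij_def)
  show "act_line g ` \<L> \<subseteq> \<L>" using act_closed[OF assms] by blast
qed

lemma all_or_none_fixed:
  "(\<forall>y\<in>\<L>. act_line sigma y = y) \<or> (\<forall>y\<in>\<L>. act_line sigma y \<noteq> y)"
  "(\<forall>y\<in>\<L>. act_line tau y = y) \<or> (\<forall>y\<in>\<L>. act_line tau y \<noteq> y)"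
proof -
  note s = act_permutes[OF G6_closed(2)] and t = act_permutes[OF G6_closed(3)]
  note comm = act_line_commute[OF points]
  show "(\<forall>y\<in>\<L>. act_line sigma y = y) \<or> (\<forall>y\<in>\<L>. act_line sigma y \<noteq> y)"
    by (rule commuting_on_3[where t = "act_line tau", OF card s t comm no_fixed_line])
  show "(\<forall>y\<in>\<L>. act_line tau y = y) \<or> (\<forall>y\<in>\<L>. act_line tau y \<noteq> y)"
    by (rule commuting_on_3[where t = "act_line sigma", OF card t s comm[symmetric] no_fixed_line])
qed

lemma sigma_tau_order_3: "act_line sigma (act_line sigma (act_line sigma L)) = L"
  "act_line tau (act_line tau (act_line tau L)) = L"
  by (rule order_3_on_3[OF card act_permutes[OF G6_closed(2)] L_in all_or_none_fixed(1)],
      rule order_3_on_3[OF card act_permutes[OF G6_closed(3)] L_in all_or_none_fixed(2)])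

text \<open>
  If \<open>tau\<close> moves the lines, it permutes them cyclically, so some power of it agrees with \<open>sigma\<close> on \<open>L\<close>.
\<close>

lemma fixed_by_tau_or_tau_power_sigma:
  "act_line tau L = L \<or> (\<exists>k. act_line sigma L = act_line (tau ^^ k) L)"
  using all_or_none_fixed(2)
proof
  assume "\<forall>y\<in>\<L>. act_line tau y = y"
  then show ?thesis using L_in by blast
next
  assume "\<forall>y\<in>\<L>. act_line tau y \<noteq> y"
  then have X: "\<L> = {L, act_line tau L, act_line tau (act_line tau L)}"
    using fixed_point_free_on_3(1)[OF card act_permutes[OF G6_closed(3)] _ L_in] by blast
  have pow: "act_line (tau ^^ 0) L = L" "act_line (tau ^^ 1) L = act_line tau L"
    "act_line (tau ^^ 2) L = act_line tau (act_line tau L)"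
    by (simp_all add: act_line_id act_line_comp numeral_2_eq_2)
  have "act_line sigma L \<in> \<L>" using act_closed[OF G6_closed(2) L_in] .
  then have "act_line sigma L = L \<or> act_line sigma L = act_line tau L
      \<or> act_line sigma L = act_line tau (act_line tau L)" unfolding X by blast
  then show ?thesis using pow by metis
qed

lemma plane_closed:
  assumes "x \<in> \<Union>L"
  shows "sigma (sigma (sigma x)) \<in> \<Union>L" "(tau ^^ 3) x \<in> \<Union>L"
proof -
  have "\<Union>L = sigma ` sigma ` sigma ` \<Union>L" using sigma_tau_order_3(1) by (metis Union_act_line)
  then show "sigma (sigma (sigma x)) \<in> \<Union>L" using assms by blast
  have "\<Union>L = tau ` tau ` tau ` \<Union>L" using sigma_tau_order_3(2) by (metis Union_act_line)
  then have "tau (tau (tau x)) \<in> \<Union>L" using assms by blast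
  then show "(tau ^^ 3) x \<in> \<Union>L" by (simp add: eval_nat_numeral)
qed

text \<open>
  The union of the points of \<open>L\<close> is a plane in \<open>\<complex>\<^sup>6\<close>, to whose vectors the relation between lines carries
  over.
\<close>

lemma plane_relation:
  "(\<forall>x\<in>\<Union>L. tau x \<in> \<Union>L) \<or> (\<exists>k. \<forall>x\<in>\<Union>L. \<exists>y\<in>\<Union>L. sigma x = (tau ^^ k) y)"
  using fixed_by_tau_or_tau_power_sigma
proof (elim disjE exE)
  assume "act_line tau L = L"
  then have "tau ` \<Union>L = \<Union>L" using Union_act_line[of tau L] by simp
  then show ?thesis by blast
next
  fix k assume "act_line sigma L = act_line (tau ^^ k) L"
  then have "sigma ` \<Union>L = (tau ^^ k) ` \<Union>L" by (simp only: flip: Union_act_line)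
  then show ?thesis by blast
qed

end

section \<open>The planes whose lines have an orbit of length 3\<close>

text \<open>
  The involution \<open>tau ^^ 3\<close> splits \<open>W\<close> into vectors of even and of odd support, and \<open>sigma ^^ 3\<close> exchanges the
  two parts. So both have dimension 1 and one generator \<open>u\<close> determines \<open>W\<close>. The even-supported vector \<open>u\<close> plays
  the role of \<open>v\<close> in \<open>\<complex>\<^sup>2 \<otimes> v\<close>.
\<close>

lemma sigma3_tau3_invariant_plane:
  assumes W: "vec.subspace W" "vec.dim W = 2"
    and s: "\<And>x. x \<in> W \<Longrightarrow> sigma (sigma (sigma x)) \<in> W" and t: "\<And>x. x \<in> W \<Longrightarrow> (tau ^^ 3) x \<in> W"
  obtains u where "u \<noteq> 0" "u $ 1 = 0" "u $ 3 = 0" "u $ 5 = 0"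
    "W = {a *s u + b *s sigma (sigma (sigma u)) | a b. True}"
proof -
  have "\<exists>u\<in>W. u \<noteq> 0 \<and> u $ 1 = 0 \<and> u $ 3 = 0 \<and> u $ 5 = 0"
  proof -
    have "\<not> W \<subseteq> {0}" using W(2) by (metis vec.dim_eq_0 zero_neq_numeral)
    then obtain x where x: "x \<in> W" "x \<noteq> 0" by auto
    \<comment> \<open>Twice the even part of \<open>x\<close>. If it vanishes, \<open>x\<close> has odd support and is shifted instead.\<close>
    define e where "e = x + (tau ^^ 3) x"
    have e: "e $ 0 = 2 * x $ 0" "e $ 1 = 0" "e $ 2 = 2 * x $ 2" "e $ 3 = 0" "e $ 4 = 2 * x $ 4" "e $ 5 = 0"
      unfolding e_def by (simp_all add: tau_funpow_weight weight_cube del: weight_simps)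
    have eW: "e \<in> W" unfolding e_def using W x t by (intro vec.subspace_add) auto
    show ?thesis
    proof (cases "e = 0")
      case False
      with e eW show ?thesis by blast
    next
      case True
      then have "x $ 0 = 0" "x $ 2 = 0" "x $ 4 = 0" using e by simp_all
      moreover from this x(2) have "sigma (sigma (sigma x)) \<noteq> 0" by (auto simp: vec6_eq_iff)
      ultimately show ?thesis using s[OF x(1)] by (intro bexI[of _ "sigma (sigma (sigma x))"]) auto
    qed
  qed
  then obtain u where u: "u \<in> W" "u \<noteq> 0" "u $ 1 = 0" "u $ 3 = 0" "u $ 5 = 0" by blast
  let ?v = "sigma (sigma (sigma u))"
  have "u \<notin> vec.span {?v}"
  proof
    assume "u \<in> vec.span {?v}"
    then obtain k where "u = k *s ?v" by (auto simp: vec.span_singleton)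
    then have "u $ i = k * u $ (i + 1 + 1 + 1)" for i by (metis sigma_nth vector_smult_component)
    from this[of 0] this[of 2] this[of 4] have "u = 0" using u by (simp add: vec6_eq_iff)
    with u show False by simp
  qed
  moreover have "?v \<noteq> 0" using u by (auto simp: vec6_eq_iff)
  moreover from calculation have "u \<noteq> ?v" using vec.span_base[of ?v "{?v}"] by auto
  ultimately have "vec.independent {u, ?v}" "card {u, ?v} = 2"
    by (auto simp: vec.independent_insert)
  then have sub: "W \<subseteq> vec.span {u, ?v}"
    using vec.card_eq_dim[of "{u, ?v}" W] W(2) u s by auto
  have "W = vec.span {u, ?v}"
    using sub vec.span_minimal[of "{u, ?v}" W] u s W(1) by blast
  also have "\<dots> = {a *s u + b *s ?v | a b. True}"
    by (auto simp: vec.span_insert vec.span_singleton algebra_simps)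
  finally show thesis using u that by blast
qed

text \<open>
  On vectors of even support these two invariants generate the Hesse pencil of plane cubics.
\<close>

definition power_sum :: "complex ^ 6 \<Rightarrow> complex" where
  "power_sum u = (u $ 0)^3 + (u $ 2)^3 + (u $ 4)^3"

definition triple_product :: "complex ^ 6 \<Rightarrow> complex" where
  "triple_product u = u $ 0 * u $ 2 * u $ 4"

text \<open>
  The vector \<open>a *s u + b *s sigma (sigma (sigma u))\<close> corresponds to \<open>(a, b) \<otimes> v\<close>: it has \<open>a v\<^sub>j\<close> at the even
  and \<open>b v\<^sub>j\<close> at the odd index congruent to \<open>j\<close> modulo 3.
\<close>

lemma cubic_on_plane:
  assumes "u $ 1 = 0" "u $ 3 = 0" "u $ 5 = 0"
  shows "cubic_even p (a *s u + b *s sigma (sigma (sigma u)))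
      = a^3 * (p $ 0 * power_sum u + p $ 1 * triple_product u)
        + a * b^2 * (p $ 2 * power_sum u + 3 * p $ 3 * triple_product u)"
    and "cubic_odd p (a *s u + b *s sigma (sigma (sigma u)))
      = b^3 * (p $ 0 * power_sum u + p $ 1 * triple_product u)
        + a^2 * b * (p $ 2 * power_sum u + 3 * p $ 3 * triple_product u)"
  unfolding cubic_even_def cubic_odd_def power_sum_def triple_product_def
  by (simp_all add: assms power2_eq_square power3_eq_cube algebra_simps)

text \<open>
  If both invariants vanished, exactly one of the three even coordinates of \<open>u\<close> would be zero. An
  eigenvector of \<open>tau\<close> has only one nonzero even coordinate, as the eigenvalues 1, \<open>weight 2\<close>, \<open>weight 4\<close> are
  distinct. A relation between \<open>sigma\<close> and a power of \<open>tau\<close> makes the three coordinates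
  multiples of each other in a cycle, so that one zero forces all.
\<close>

lemma plane_invariants_nonzero:
  assumes u: "u \<noteq> 0" "u $ 1 = 0" "u $ 3 = 0" "u $ 5 = 0"
    and W: "W = {a *s u + b *s sigma (sigma (sigma u)) | a b. True}"
    and rel: "(\<forall>x\<in>W. tau x \<in> W) \<or> (\<exists>k. \<forall>x\<in>W. \<exists>y\<in>W. sigma x = (tau ^^ k) y)"
  shows "power_sum u \<noteq> 0 \<or> triple_product u \<noteq> 0"
proof (rule ccontr)
  assume "\<not> ?thesis"
  then have 0: "power_sum u = 0" "triple_product u = 0" by auto
  have "u \<in> W" unfolding W by (intro CollectI exI[of _ 1] exI[of _ 0]) simp
  from rel show False
  proof (elim disjE exE)
    assume "\<forall>x\<in>W. tau x \<in> W"
    with \<open>u \<in> W\<close> obtain a b where "tau u = a *s u + b *s sigma (sigma (sigma u))" unfolding W by blast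
    then have *: "tau u $ i = a * u $ i + b * u $ (i + 1 + 1 + 1)" for i by simp
    have "u $ 0 = a * u $ 0" "rho^2 * u $ 2 = a * u $ 2" "rho^4 * u $ 4 = a * u $ 4"
      using *[of 0] *[of 2] *[of 4] u by simp_all
    then have c: "u $ 0 = 0 \<or> a = 1" "u $ 2 = 0 \<or> a = weight 2" "u $ 4 = 0 \<or> a = weight 4" by auto
    have "weight 2 \<noteq> 1" "weight 4 \<noteq> 1" by (simp_all only: weight_eq_1_iff)
      (simp_all add: bit0.Rep_inject_sym bit0.Rep_numeral bit0.Rep_0)
    moreover have "weight 4 = weight 2 * weight 2" by (simp del: weight_simps flip: weight_add)
    have "w \<noteq> w * w" if "w \<noteq> 1" "w \<noteq> 0" for w :: complex using that by simp
    then have "weight 2 \<noteq> weight 4"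
      using \<open>weight 2 \<noteq> 1\<close> \<open>weight 4 = weight 2 * weight 2\<close> rho_root(3) by (metis weight_simps(3) power_not_zero)
    ultimately have "(u $ 0 = 0 \<and> u $ 2 = 0) \<or> (u $ 0 = 0 \<and> u $ 4 = 0) \<or> (u $ 2 = 0 \<and> u $ 4 = 0)"
      using c by metis
    with 0(1) have "u $ 0 = 0 \<and> u $ 2 = 0 \<and> u $ 4 = 0" by (auto simp: power_sum_def)
    with u show False by (simp add: vec6_eq_iff)
  next
    fix k assume "\<forall>x\<in>W. \<exists>y\<in>W. sigma x = (tau ^^ k) y"
    with \<open>u \<in> W\<close> obtain a b where ab: "sigma u = (tau ^^ k) (a *s u + b *s sigma (sigma (sigma u)))"
      unfolding W by blast
    have *: "u $ (i + 1) = weight i ^ k * (a * u $ i + b * u $ (i + 1 + 1 + 1))" for i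
      using arg_cong[OF ab, of "\<lambda>x. x $ i"] by (simp add: tau_funpow_weight)
    have "u $ 2 = weight 1 ^ k * (b * u $ 4)" "u $ 4 = weight 3 ^ k * (b * u $ 0)" "u $ 0 = weight 5 ^ k * (b * u $ 2)"
      using *[of 1] *[of 3] *[of 5] u by simp_all
    moreover have "u $ 0 = 0 \<or> u $ 2 = 0 \<or> u $ 4 = 0" using 0(2) by (auto simp: triple_product_def)
    ultimately have "u $ 0 = 0 \<and> u $ 2 = 0 \<and> u $ 4 = 0" by (metis mult_zero_right)
    with u show False by (simp add: vec6_eq_iff)
  qed
qed

section \<open>Pencils through an orbit of three lines\<close>

lemma pencil_of_span: "pencil_of (vec.span {p}) = pencil p"
proof -
  let ?P = "vec.span {p}"
  have "cubic_even ` ?P \<union> cubic_odd ` ?P \<subseteq> pencil p"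
  proof -
    have "cubic_even (c *s p) \<in> pencil p" "cubic_odd (c *s p) \<in> pencil p" for c
    proof -
      have "cubic_odd (c *s p) = (\<lambda>x. c * cubic_odd p x)"
        by (simp add: cubic_odd_eq cubic_even_scale fun_eq_iff)
      then show "cubic_even (c *s p) \<in> pencil p" "cubic_odd (c *s p) \<in> pencil p"
        unfolding pencil_def cubic_even_scale
        by (simp_all add: form.span_scale form.span_base)
    qed
    then show ?thesis by (auto simp: vec.span_singleton)
  qed
  then have "pencil_of ?P \<subseteq> pencil p"
    unfolding pencil_of_def pencil_def by (intro form.span_minimal) auto
  moreover have "pencil p \<subseteq> pencil_of ?P"
    unfolding pencil_of_def pencil_def by (intro form.span_mono) (auto intro: vec.span_base)
  ultimately show ?thesis by blast
qed

text \<open>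
  The parameters are recovered from the pencil up to a factor: its \<open>tau\<close>-fixed forms are the multiples of
  the first cubic, and a cubic determines its coefficients.
\<close>

lemma pencil_eq_imp_span_eq:
  assumes "p \<noteq> 0" "pencil p = pencil q"
  shows "vec.span {p} = vec.span {q}"
proof -
  have "cubic_even p \<in> pencil p" unfolding pencil_def by (rule form.span_base) simp
  then have "cubic_even p \<in> pencil q" unfolding assms(2) .
  then obtain a b where ab: "cubic_even p = (\<lambda>x. a * cubic_even q x + b * cubic_odd q x)"
    unfolding pencil_def in_span_pair_iff by blast
  have "b * cubic_odd q x = 0" for x
  proof -
    have "cubic_even p (tau x) = cubic_even p x" by (simp add: cubic_tau)
    then show ?thesis unfolding ab by (simp add: cubic_tau)
  qed
  then have "cubic_even p = cubic_even (a *s q)" unfolding ab cubic_even_scale by (simp add: fun_eq_iff)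
  then have pq: "p = a *s q" by (rule cubic_even_inj)
  then have "a \<noteq> 0" using assms(1) by auto
  then have "q = (1 / a) *s p" using pq by simp
  then have "q \<in> vec.span {p}" by (metis vec.span_base vec.span_scale singletonI)
  moreover have "p \<in> vec.span {q}" unfolding pq by (intro vec.span_scale vec.span_base) simp
  ultimately show ?thesis by (intro subset_antisym vec.span_minimal) auto
qed

text \<open>
  A form vanishes on the image of a line under \<open>g\<close> if and only if its composition with \<open>g\<close>, which is again
  in \<open>V\<close>, vanishes on the line itself.
\<close>

lemma contains_line_orbit_iff:
  assumes V: "V \<in> G6_invariant_pencils" and L: "L \<in> proj_lines"
    and orbit: "\<L> = {act_line g L | g. g \<in> carrier G6}"
  shows "contains_lines V \<L> \<longleftrightarrow> (\<forall>F\<in>V. \<forall>x\<in>\<Union>L. F x = 0)"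
proof
  assume V0: "contains_lines V \<L>"
  have "L \<in> \<L>" unfolding orbit using G6_closed(1) act_line_id[of L, symmetric] by blast
  with V0 show "\<forall>F\<in>V. \<forall>x\<in>\<Union>L. F x = 0" unfolding contains_lines_def zero_locus_def by blast
next
  assume 0: "\<forall>F\<in>V. \<forall>x\<in>\<Union>L. F x = 0"
  have pts: "L \<subseteq> proj_points" using L unfolding proj_lines_def by blast
  show "contains_lines V \<L>"
    unfolding contains_lines_def
  proof (intro ballI subsetI)
    fix F L' P assume F: "F \<in> V" and "L' \<in> \<L>" "P \<in> L'"
    then obtain g Q where g: "g \<in> carrier G6" and Q: "Q \<in> L" and P: "P = g ` Q"
      unfolding orbit act_line_def by blast
    have "F \<circ> g \<in> V" using V F g unfolding G6_invariant_pencils_def by blast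
    then have "(F \<circ> g) x = 0" if "x \<in> Q" for x using 0 Q that by blast
    then have "\<forall>x\<in>P. F x = 0" unfolding P by simp
    moreover have "P \<in> proj_points" using G6_image_proj_point[OF g] Q pts unfolding P by blast
    ultimately show "P \<in> zero_locus F" by (simp add: zero_locus_def)
  qed
qed

definition parameter_plane :: "complex \<Rightarrow> complex \<Rightarrow> (complex ^ 4) set" where
  "parameter_plane A B = {p. p $ 0 * A + p $ 1 * B = 0 \<and> p $ 2 * A + 3 * p $ 3 * B = 0}"

text \<open>
  The two equations concern disjoint pairs of coordinates and neither is trivial. A basis of solutions
  is \<open>(B, -A, 0, 0)\<close>, \<open>(0, 0, 3B, -A)\<close>.
\<close>

lemma parameter_plane_dim:
  assumes "A \<noteq> 0 \<or> B \<noteq> 0"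
  shows "vec.subspace (parameter_plane A B)" "vec.dim (parameter_plane A B) = 2"
proof -
  show K: "vec.subspace (parameter_plane A B)"
  proof (rule vec.subspaceI)
    show "0 \<in> parameter_plane A B" by (simp add: parameter_plane_def)
  next
    fix p q assume "p \<in> parameter_plane A B" "q \<in> parameter_plane A B"
    moreover have
      "(p $ 0 + q $ 0) * A + (p $ 1 + q $ 1) * B = (p $ 0 * A + p $ 1 * B) + (q $ 0 * A + q $ 1 * B)"
      "(p $ 2 + q $ 2) * A + 3 * (p $ 3 + q $ 3) * B
        = (p $ 2 * A + 3 * p $ 3 * B) + (q $ 2 * A + 3 * q $ 3 * B)"
      by algebra+
    ultimately show "p + q \<in> parameter_plane A B" by (simp add: parameter_plane_def)
  next
    fix c p assume "p \<in> parameter_plane A B"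
    moreover have "c * p $ 0 * A + c * p $ 1 * B = c * (p $ 0 * A + p $ 1 * B)"
      "c * p $ 2 * A + 3 * (c * p $ 3) * B = c * (p $ 2 * A + 3 * p $ 3 * B)"
      by algebra+
    ultimately show "c *s p \<in> parameter_plane A B" by (simp add: parameter_plane_def)
  qed
  define k1 :: "complex ^ 4" where "k1 = (\<chi> i. if i = 0 then B else if i = 1 then - A else 0)"
  define k2 :: "complex ^ 4" where "k2 = (\<chi> i. if i = 2 then 3 * B else if i = 3 then - A else 0)"
  have k1: "k1 $ 0 = B" "k1 $ 1 = - A" "k1 $ 2 = 0" "k1 $ 3 = 0"
    and k2: "k2 $ 0 = 0" "k2 $ 1 = 0" "k2 $ 2 = 3 * B" "k2 $ 3 = - A"
    by (simp_all add: k1_def k2_def)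
  have span: "p \<in> vec.span {k1, k2} \<longleftrightarrow> (\<exists>a b. p = a *s k1 + b *s k2)" for p
    by (auto simp: vec.span_insert vec.span_singleton algebra_simps)
  have "k2 \<noteq> 0" using assms k2 by (auto simp: vec_eq_iff forall_4_from_0)
  moreover have "k1 \<notin> vec.span {k2}"
    using assms k1 k2 by (auto simp: vec.span_singleton vec_eq_iff forall_4_from_0)
  moreover from this have "k1 \<noteq> k2" using vec.span_base[of k2 "{k2}"] by auto
  ultimately have ind: "vec.independent {k1, k2}" "card {k1, k2} = 2"
    by (auto simp: vec.independent_insert)
  have "parameter_plane A B = vec.span {k1, k2}"
  proof
    show "vec.span {k1, k2} \<subseteq> parameter_plane A B"
      using K by (intro vec.span_minimal) (auto simp: parameter_plane_def k1 k2)
    show "parameter_plane A B \<subseteq> vec.span {k1, k2}"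
    proof
      fix p assume "p \<in> parameter_plane A B"
      then have p: "p $ 0 * A + p $ 1 * B = 0" "p $ 2 * A + 3 * p $ 3 * B = 0"
        by (auto simp: parameter_plane_def)
      have "\<exists>a b. p = a *s k1 + b *s k2"
      proof (cases "A = 0")
        case True
        then have "p = (p $ 0 / B) *s k1 + (p $ 2 / (3 * B)) *s k2"
          using assms p by (simp add: vec_eq_iff forall_4_from_0 k1 k2)
        then show ?thesis by blast
      next
        case False
        then have "p $ 0 = - (p $ 1 * B) / A" "p $ 2 = - (3 * p $ 3 * B) / A"
          using p by (simp_all add: field_simps add_eq_0_iff2)
        then have "p = (- p $ 1 / A) *s k1 + (- p $ 3 / A) *s k2"
          using False by (simp add: vec_eq_iff forall_4_from_0 k1 k2)
        then show ?thesis by blast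
      qed
      then show "p \<in> vec.span {k1, k2}" unfolding span .
    qed
  qed
  then show "vec.dim (parameter_plane A B) = 2"
    using vec.dim_span_eq_card_independent[OF ind(1)] ind(2) by simp
qed

theorem proposition7p7:
  fixes \<L> :: "(complex ^ 6) set set set"
  assumes "\<L> \<in> G6_line_orbits"
    and "card \<L> = 3"
  shows "\<exists>M \<in> proj_lines.
           bij_betw pencil_of M {V \<in> G6_invariant_pencils. contains_lines V \<L>}
         \<and> (\<forall>M' \<in> proj_lines. (\<forall>P \<in> M'. contains_lines (pencil_of P) \<L>) \<longrightarrow> M' = M)"
proof -
  obtain L where L: "L \<in> proj_lines" and orbit: "\<L> = {act_line g L | g. g \<in> carrier G6}"
    using assms(1) unfolding G6_line_orbits_def orbits_def orbit_def by blast
  interpret three_line_orbit \<L> L by unfold_locales (fact L orbit assms(2))+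
  obtain W where W: "vec.subspace W" "vec.dim W = 2" and UL: "\<Union>L = W"
    using proj_lineE[OF L] by blast
  obtain u where u: "u \<noteq> 0" "u $ 1 = 0" "u $ 3 = 0" "u $ 5 = 0"
    and W_eq: "W = {a *s u + b *s sigma (sigma (sigma u)) | a b. True}"
    using sigma3_tau3_invariant_plane[OF W plane_closed[unfolded UL]] by blast
  define A B where "A = power_sum u" and "B = triple_product u"
  have AB: "A \<noteq> 0 \<or> B \<noteq> 0"
    unfolding A_def B_def using plane_invariants_nonzero[OF u W_eq plane_relation[unfolded UL]] .
  define K where "K = parameter_plane A B"
  note K = parameter_plane_dim[OF AB, folded K_def]
  note cubic = cubic_on_plane[OF u(2-4), folded A_def B_def]
  have contains: "contains_lines (pencil p) \<L> \<longleftrightarrow> p \<in> K" if "p \<noteq> 0" for p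
  proof -
    have "contains_lines (pencil p) \<L> \<longleftrightarrow> (\<forall>F\<in>pencil p. \<forall>x\<in>W. F x = 0)"
      using contains_line_orbit_iff[OF pencil_invariant[OF that] L orbit] UL by simp
    also have "\<dots> \<longleftrightarrow> p \<in> K"
    proof
      assume "\<forall>F\<in>pencil p. \<forall>x\<in>W. F x = 0"
      moreover have "cubic_even p \<in> pencil p" unfolding pencil_def by (rule form.span_base) simp
      ultimately have 0: "cubic_even p (a *s u + b *s sigma (sigma (sigma u))) = 0" for a b
        unfolding W_eq by blast
      show "p \<in> K" using 0[of 1 0] 0[of 1 1] unfolding cubic K_def parameter_plane_def by simp
    next
      assume "p \<in> K"
      then have p: "p $ 0 * A + p $ 1 * B = 0" "p $ 2 * A + 3 * p $ 3 * B = 0"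
        unfolding K_def parameter_plane_def by simp_all
      have 0: "cubic_even p x = 0" "cubic_odd p x = 0" if x: "x \<in> W" for x
      proof -
        from x obtain a b where ab: "x = a *s u + b *s sigma (sigma (sigma u))" unfolding W_eq by blast
        show "cubic_even p x = 0" "cubic_odd p x = 0" unfolding ab cubic p by simp_all
      qed
      show "\<forall>F\<in>pencil p. \<forall>x\<in>W. F x = 0"
        unfolding pencil_def by (auto simp: in_span_pair_iff 0)
    qed
    finally show ?thesis .
  qed
  define M where "M = {P \<in> proj_points. P \<subseteq> K}"
  have in_M: "vec.span {p} \<in> M \<longleftrightarrow> p \<in> K" if "p \<noteq> 0" for p
    unfolding M_def using proj_point_span[OF that] vec.span_minimal[of "{p}" K] K(1) vec.span_base[of p "{p}"] by blast
  show ?thesis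
  proof (intro bexI conjI ballI impI)
    show "M \<in> proj_lines" unfolding proj_lines_def M_def using K by blast
    show "bij_betw pencil_of M {V \<in> G6_invariant_pencils. contains_lines V \<L>}"
      unfolding bij_betw_def
    proof
      show "inj_on pencil_of M"
      proof (rule inj_onI)
        fix P Q assume "P \<in> M" "Q \<in> M" and eq: "pencil_of P = pencil_of Q"
        then have "P \<in> proj_points" "Q \<in> proj_points" by (auto simp: M_def)
        then obtain p q where "p \<noteq> 0" "P = vec.span {p}" "Q = vec.span {q}" by (metis proj_pointE)
        with eq pencil_eq_imp_span_eq[of p q] show "P = Q" by (simp add: pencil_of_span)
      qed
      show "pencil_of ` M = {V \<in> G6_invariant_pencils. contains_lines V \<L>}"
      proof (intro subset_antisym subsetI)
        fix V assume "V \<in> pencil_of ` M"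
        then obtain P where P: "P \<in> M" "V = pencil_of P" by blast
        then have "P \<in> proj_points" by (simp add: M_def)
        then obtain p where p: "p \<noteq> 0" "P = vec.span {p}" by (rule proj_pointE)
        have "p \<in> K" using P(1) unfolding p(2) in_M[OF p(1)] .
        then show "V \<in> {V \<in> G6_invariant_pencils. contains_lines V \<L>}"
          unfolding P(2) p(2) pencil_of_span using pencil_invariant[OF p(1)] contains[OF p(1)] by blast
      next
        fix V assume "V \<in> {V \<in> G6_invariant_pencils. contains_lines V \<L>}"
        then have V: "V \<in> G6_invariant_pencils" "contains_lines V \<L>" by auto
        obtain p where p: "p \<noteq> 0" "V = pencil p" using invariant_pencil_classification[OF V(1)] .
        then have "vec.span {p} \<in> M" using V(2) contains[OF p(1)] in_M[OF p(1)] by simp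
        then show "V \<in> pencil_of ` M" unfolding p(2) pencil_of_span[symmetric] by (rule imageI)
      qed
    qed
  next
    fix M' assume M': "M' \<in> proj_lines" "\<forall>P\<in>M'. contains_lines (pencil_of P) \<L>"
    obtain U where U: "vec.subspace U" "vec.dim U = 2" and M'_eq: "M' = {P \<in> proj_points. P \<subseteq> U}"
      using proj_lineE[OF M'(1)] by blast
    have "p \<in> K" if "p \<in> U" for p
    proof (cases "p = 0")
      case True
      then show ?thesis using K(1) vec.subspace_0 by blast
    next
      case False
      have "vec.span {p} \<in> M'"
        unfolding M'_eq using proj_point_span[OF False] vec.span_minimal[of "{p}" U] U(1) that by blast
      then show ?thesis using M'(2) contains[OF False] by (auto simp: pencil_of_span)
    qed
    then have "U = K" using U K by (intro vec.subspace_dim_equal) auto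
    then show "M' = M" unfolding M'_eq M_def by simp
  qed
qed

end
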